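(* Let $f:F\to G$ be a morphism of perfect idylls, let $N$ and $M$ be $F$-matroids and let $\Phi:N\to M$ be an $F$-morphism. Then the push-forward $f_\ast\Phi$ is a $G$-morphism $f_\ast\Phi:f_\ast N\to f_\ast M$. This defines a functor $f_\ast:\mathrm{Mat}_F\to\mathrm{Mat}_G$.
   Context: An idyll is a commutative multiplicative monoid $F$ with an element $0$ satisfying $0\cdot a=0$ for all $a$ and such that $F^\times=F\setminus\{0\}$ is an abelian group, together with a subset $N_F$ (the nullset) of the group semiring $\mathbb N[F^\times]$ (where $0\in F$ is identified with the empty sum) such that $0\in N_F$, $1\notin N_F$, $N_F+N_F\subseteq N_F$, $\mathbb N[F^\times]\cdot N_F\subseteq N_F$, and there is a unique element $-1\in F^\times$ with $1+(-1)\in N_F$. A morphism of idylls $f:F\to G$ is a multiplicative map with $f(0)=0$, $f(1)=1$ and $\sum f(a_i)\in N_G$ for all $\sum a_i\in N_F$. Let $E$ be a finite set and $r\ge 0$. A Grassmann-Plücker function of rank $r$ on $E$ with coefficients in $F$ is a nonzero function $\varphi:E^r\to F$ that is alternating (i.e. $\varphi(x_{\sigma(1)},\dots,x_{\sigma(r)})=\mathrm{sign}(\sigma)\varphi(x_1,\dots,x_r)$ for all permutations $\sigma$, and $\varphi(x_1,\dots,x_r)=0$ if the $x_i$ are not pairwise distinct) and satisfies $\sum_{k=0}^r(-1)^k\varphi(y_0,\dots,\widehat{y_k},\dots,y_r)\varphi(y_k,x_2,\dots,x_r)\in N_F$ for all $x_2,\dots,x_r,y_0,\dots,y_r\in E$.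 An $F$-matroid of rank $r$ on $E$ is a class $M=[\varphi]$ of such functions up to multiplication by elements of $F^\times$. Dual: fix a total order on $E$ and let $n=\#E$; $M^*=[\varphi^*]$ with $\varphi^*:E^{n-r}\to F$, $\varphi^*(x)=0$ if $x$ has repeated entries, and $\varphi^*(x)=\mathrm{sign}(x,x')\varphi(x')$ otherwise, where $x'\in E^r$ lists the complement of the entries of $x$ and $\mathrm{sign}(x,x')\in\{\pm1\}$ is the sign of the permutation sorting $(x,x')$. Circuits: $\mathcal C_M\subseteq F^E$ consists of all $aX_y$ with $a\in F^\times$ and $y=(y_0,\dots,y_r)\in E^{r+1}$ with distinct entries and $\varphi(y_0,\dots,\widehat{y_k},\dots,y_r)\ne0$ for some $k$, where $X_y(y_i)=(-1)^i\varphi(y_0,\dots,\widehat{y_i},\dots,y_r)$ and $X_y(x)=0$ for other $x$. Cocircuits: $\mathcal C_M^*=\mathcal C_{M^*}$. For $X,Y\in F^E$ write $X\perp Y$ if $\sum_{e}X_eY_e\in N_F$. Vectors: $\mathcal V_M=\{X\in F^E: X\perp Y\ \forall Y\in\mathcal C_M^*\}$. Covectors: $\mathcal V_M^*=\{X\in F^E:X\perp Y\ \forall Y\in\mathcal C_M\}$. The idyll $F$ is perfect if $X\perp Y$ for all $F$-matroids $M$, $X\in\mathcal V_M$, $Y\in\mathcal V_M^*$. Let $F$ be a perfect idyll. A submonomial $F$-matrix indexed by $T\times S$ (finite sets) is a matrix $\Phi=(\Phi_{i,j})_{(i,j)\in T\times S}$ with entries in $F$ such that each row and each column has at most one nonzero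 entry; it defines a map $F^S\to F^T$, $(\Phi\cdot X)_i=\sum_{j}\Phi_{i,j}X_j$ (at most one nonzero term). For $F$-matroids $N$ on $S$ and $M$ on $T$, an $F$-morphism $\Phi:N\to M$ is a submonomial $F$-matrix indexed by $T\times S$ with $\Phi\cdot\mathcal V_N\subseteq\mathcal V_M$. $\mathrm{Mat}_F$ is the category of $F$-matroids with $F$-morphisms, composed by matrix multiplication. Push-forward along $f:F\to G$: $f_\ast[\varphi]=[f\circ\varphi]$ for $F$-matroids, and $(f_\ast\Phi)_{i,j}=f(\Phi_{i,j})$ for submonomial $F$-matrices. *)

theory Defs
  imports "HOL-Algebra.Group" "HOL-Combinatorics.Permutations"
begin

section \<open>Idylls\<close>

text \<open>An element of the group semiring of finite formal sums of units with coefficients in the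
  natural numbers is a multiset of nonzero elements of the carrier.\<close>

record 'a pre_idyll = "'a monoid" +
  zer :: 'a
  nullset :: "'a multiset set"

definition nonzero :: "('a, 'm) pre_idyll_scheme \<Rightarrow> 'a set"
  where "nonzero F = carrier F - {zer F}"

definition semiring_mult :: "('a, 'm) pre_idyll_scheme \<Rightarrow> 'a multiset \<Rightarrow> 'a multiset \<Rightarrow> 'a multiset"
  where "semiring_mult F A B = (\<Sum>\<^sub># {# {# a \<otimes>\<^bsub>F\<^esub> b. b \<in># B #}. a \<in># A #})"

locale idyll = comm_monoid F for F (structure) +
  assumes zer_closed: "zer F \<in> carrier F"
    and zer_mult: "a \<in> carrier F \<Longrightarrow> zer F \<otimes> a = zer F"
    and nonzero_group: "comm_group (F\<lparr>carrier := nonzero F\<rparr>)"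
    and nullset_formal_sums: "A \<in> nullset F \<Longrightarrow> set_mset A \<subseteq> nonzero F"
    and empty_null: "{#} \<in> nullset F"
    and one_not_null: "{#\<one>#} \<notin> nullset F"
    and add_null: "\<lbrakk>A \<in> nullset F; B \<in> nullset F\<rbrakk> \<Longrightarrow> A + B \<in> nullset F"
    and mult_null: "\<lbrakk>set_mset A \<subseteq> nonzero F; B \<in> nullset F\<rbrakk> \<Longrightarrow> semiring_mult F A B \<in> nullset F"
    and ex1_neg_one: "\<exists>!e. e \<in> nonzero F \<and> {#\<one>, e#} \<in> nullset F"

definition neg_one :: "('a, 'm) pre_idyll_scheme \<Rightarrow> 'a"
  where "neg_one F = (THE e. e \<in> nonzero F \<and> {#\<one>\<^bsub>F\<^esub>, e#} \<in> nullset F)"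

definition of_sign :: "('a, 'm) pre_idyll_scheme \<Rightarrow> int \<Rightarrow> 'a"
  where "of_sign F s = (if s = 1 then \<one>\<^bsub>F\<^esub> else neg_one F)"

text \<open>Since zero is identified with the empty sum, zero terms are discarded from a sum of elements
  of the idyll before it is compared with the nullset.\<close>

definition is_null :: "('a, 'm) pre_idyll_scheme \<Rightarrow> 'a multiset \<Rightarrow> bool"
  where "is_null F A \<longleftrightarrow> {# a \<in># A. a \<noteq> zer F #} \<in> nullset F"

definition idyll_hom :: "('a, 'm) pre_idyll_scheme \<Rightarrow> ('b, 'n) pre_idyll_scheme \<Rightarrow> ('a \<Rightarrow> 'b) \<Rightarrow> bool"
  where "idyll_hom F G f \<longleftrightarrow>
    f \<in> hom F G \<and> f (zer F) = zer G \<and> f \<one>\<^bsub>F\<^esub> = \<one>\<^bsub>G\<^esub> \<and>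
    (\<forall>A \<in> nullset F. is_null G (image_mset f A))"


section \<open>Matroids with coefficients in an idyll\<close>

text \<open>\<open>tuples E r\<close> is the set of \<open>r\<close>-tuples of elements of \<open>E\<close>. Functions on a set are represented
  extensionally, so that equality of functions is equality in HOL.\<close>

definition tuples :: "'e set \<Rightarrow> nat \<Rightarrow> 'e list set"
  where "tuples E r = {xs. set xs \<subseteq> E \<and> length xs = r}"

definition omit :: "nat \<Rightarrow> 'e list \<Rightarrow> 'e list"
  where "omit k ys = take k ys @ drop (Suc k) ys"

text \<open>In the last clause, \<open>xs\<close> is \<open>(x\<^sub>2, \<dots>, x\<^sub>r)\<close> and \<open>ys\<close> is \<open>(y\<^sub>0, \<dots>, y\<^sub>r)\<close>; the condition is
  vacuous for \<open>r = 0\<close>.\<close>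

definition grassmann_pluecker ::
    "('a, 'm) pre_idyll_scheme \<Rightarrow> 'e set \<Rightarrow> nat \<Rightarrow> ('e list \<Rightarrow> 'a) \<Rightarrow> bool"
  where "grassmann_pluecker F E r \<phi> \<longleftrightarrow>
    \<phi> \<in> tuples E r \<rightarrow>\<^sub>E carrier F \<and>
    (\<exists>xs \<in> tuples E r. \<phi> xs \<noteq> zer F) \<and>
    (\<forall>xs \<in> tuples E r. \<forall>\<sigma>. \<sigma> permutes {..<r} \<longrightarrow>
      \<phi> (permute_list \<sigma> xs) = of_sign F (sign \<sigma>) \<otimes>\<^bsub>F\<^esub> \<phi> xs) \<and>
    (\<forall>xs \<in> tuples E r. \<not> distinct xs \<longrightarrow> \<phi> xs = zer F) \<and>
    (\<forall>xs ys. set xs \<subseteq> E \<and> Suc (length xs) = r \<and> ys \<in> tuples E (Suc r) \<longrightarrow>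
      is_null F {# neg_one F [^]\<^bsub>F\<^esub> k \<otimes>\<^bsub>F\<^esub> \<phi> (omit k ys) \<otimes>\<^bsub>F\<^esub> \<phi> (ys ! k # xs). k \<in># mset_set {0..r} #})"

record ('e, 'a) pre_matroid =
  ground :: "'e set"
  mrank :: nat
  gpclass :: "('e list \<Rightarrow> 'a) set"

definition gp_class ::
    "('a, 'm) pre_idyll_scheme \<Rightarrow> 'e set \<Rightarrow> nat \<Rightarrow> ('e list \<Rightarrow> 'a) \<Rightarrow> ('e list \<Rightarrow> 'a) set"
  where "gp_class F E r \<phi> = {(\<lambda>xs \<in> tuples E r. a \<otimes>\<^bsub>F\<^esub> \<phi> xs) | a. a \<in> nonzero F}"

definition is_matroid :: "('a, 'm) pre_idyll_scheme \<Rightarrow> ('e, 'a) pre_matroid \<Rightarrow> bool"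
  where "is_matroid F M \<longleftrightarrow> finite (ground M) \<and>
    (\<exists>\<phi>. grassmann_pluecker F (ground M) (mrank M) \<phi> \<and>
         gpclass M = gp_class F (ground M) (mrank M) \<phi>)"


subsection \<open>Duality\<close>

text \<open>\<open>enum A\<close> lists a finite set \<open>A\<close> without repetition in a fixed but arbitrary order. On the
  ground set it plays the role of the chosen total order; a different choice changes the dual
  function only by a global sign. On a complement it gives an admissible \<open>x'\<close>, on whose order the
  dual function does not depend.\<close>

definition enum :: "'e set \<Rightarrow> 'e list"
  where "enum A = (SOME xs. distinct xs \<and> set xs = A)"

definition sorting_sign :: "'e set \<Rightarrow> 'e list \<Rightarrow> int"
  where "sorting_sign E zs = sign (THE \<sigma>. \<sigma> permutes {..<length zs} \<and> permute_list \<sigma> zs = enum E)"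

definition dual_gp ::
    "('a, 'm) pre_idyll_scheme \<Rightarrow> 'e set \<Rightarrow> nat \<Rightarrow> ('e list \<Rightarrow> 'a) \<Rightarrow> 'e list \<Rightarrow> 'a"
  where "dual_gp F E r \<phi> = (\<lambda>xs \<in> tuples E (card E - r).
    if distinct xs
    then let xs' = enum (E - set xs) in of_sign F (sorting_sign E (xs @ xs')) \<otimes>\<^bsub>F\<^esub> \<phi> xs'
    else zer F)"

text \<open>An operation on classes given by an operation on representatives is written as the union of
  the resulting classes over all representatives.\<close>

definition dual :: "('a, 'm) pre_idyll_scheme \<Rightarrow> ('e, 'a) pre_matroid \<Rightarrow> ('e, 'a) pre_matroid"
  where "dual F M =
    \<lparr>ground = ground M,
     mrank = card (ground M) - mrank M,
     gpclass = (\<Union>\<phi> \<in> gpclass M. gp_class F (ground M) (card (ground M) - mrank M)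
                                  (dual_gp F (ground M) (mrank M) \<phi>))\<rparr>"


subsection \<open>Circuits, vectors and perfection\<close>

definition fund_circuit ::
    "('a, 'm) pre_idyll_scheme \<Rightarrow> 'e set \<Rightarrow> ('e list \<Rightarrow> 'a) \<Rightarrow> 'e list \<Rightarrow> 'e \<Rightarrow> 'a"
  where "fund_circuit F E \<phi> ys = (\<lambda>e \<in> E.
    if e \<in> set ys
    then let i = (THE i. i < length ys \<and> ys ! i = e) in neg_one F [^]\<^bsub>F\<^esub> i \<otimes>\<^bsub>F\<^esub> \<phi> (omit i ys)
    else zer F)"

definition circuits :: "('a, 'm) pre_idyll_scheme \<Rightarrow> ('e, 'a) pre_matroid \<Rightarrow> ('e \<Rightarrow> 'a) set"
  where "circuits F M =
    {(\<lambda>e \<in> ground M. a \<otimes>\<^bsub>F\<^esub> fund_circuit F (ground M) \<phi> ys e) | a \<phi> ys.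
       a \<in> nonzero F \<and> \<phi> \<in> gpclass M \<and> ys \<in> tuples (ground M) (Suc (mrank M)) \<and> distinct ys \<and>
       (\<exists>k \<le> mrank M. \<phi> (omit k ys) \<noteq> zer F)}"

definition cocircuits :: "('a, 'm) pre_idyll_scheme \<Rightarrow> ('e, 'a) pre_matroid \<Rightarrow> ('e \<Rightarrow> 'a) set"
  where "cocircuits F M = circuits F (dual F M)"

definition orthogonal ::
    "('a, 'm) pre_idyll_scheme \<Rightarrow> 'e set \<Rightarrow> ('e \<Rightarrow> 'a) \<Rightarrow> ('e \<Rightarrow> 'a) \<Rightarrow> bool"
  where "orthogonal F E X Y \<longleftrightarrow> is_null F {# X e \<otimes>\<^bsub>F\<^esub> Y e. e \<in># mset_set E #}"

definition vectors :: "('a, 'm) pre_idyll_scheme \<Rightarrow> ('e, 'a) pre_matroid \<Rightarrow> ('e \<Rightarrow> 'a) set"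
  where "vectors F M =
    {X \<in> ground M \<rightarrow>\<^sub>E carrier F. \<forall>Y \<in> cocircuits F M. orthogonal F (ground M) X Y}"

definition covectors :: "('a, 'm) pre_idyll_scheme \<Rightarrow> ('e, 'a) pre_matroid \<Rightarrow> ('e \<Rightarrow> 'a) set"
  where "covectors F M =
    {X \<in> ground M \<rightarrow>\<^sub>E carrier F. \<forall>Y \<in> circuits F M. orthogonal F (ground M) X Y}"

text \<open>A definition cannot quantify over the type of the elements of the ground set. Matroids on
  finite sets of natural numbers suffice: every finite set is in bijection with one of these.\<close>

definition perfect_idyll :: "('a, 'm) pre_idyll_scheme \<Rightarrow> bool"
  where "perfect_idyll F \<longleftrightarrow> idyll F \<and>
    (\<forall>M :: (nat, 'a) pre_matroid. is_matroid F M \<longrightarrow>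
      (\<forall>X \<in> vectors F M. \<forall>Y \<in> covectors F M. orthogonal F (ground M) X Y))"


section \<open>Submonomial matrices and morphisms of matroids\<close>

definition submonomial ::
    "('a, 'm) pre_idyll_scheme \<Rightarrow> 't set \<Rightarrow> 's set \<Rightarrow> ('t \<times> 's \<Rightarrow> 'a) \<Rightarrow> bool"
  where "submonomial F T S \<Phi> \<longleftrightarrow>
    \<Phi> \<in> T \<times> S \<rightarrow>\<^sub>E carrier F \<and>
    (\<forall>i \<in> T. \<exists>\<^sub>\<le>\<^sub>1 j. j \<in> S \<and> \<Phi> (i, j) \<noteq> zer F) \<and>
    (\<forall>j \<in> S. \<exists>\<^sub>\<le>\<^sub>1 i. i \<in> T \<and> \<Phi> (i, j) \<noteq> zer F)"

text \<open>An idyll has no addition; a sum in \<open>F\<close> only makes sense if at most one term is nonzero,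
  which is the case for all sums that occur in products with submonomial matrices.\<close>

definition sum_single :: "('a, 'm) pre_idyll_scheme \<Rightarrow> 's set \<Rightarrow> ('s \<Rightarrow> 'a) \<Rightarrow> 'a"
  where "sum_single F S g =
    (if \<exists>j \<in> S. g j \<noteq> zer F then g (THE j. j \<in> S \<and> g j \<noteq> zer F) else zer F)"

definition mat_vec ::
    "('a, 'm) pre_idyll_scheme \<Rightarrow> 't set \<Rightarrow> 's set \<Rightarrow> ('t \<times> 's \<Rightarrow> 'a) \<Rightarrow> ('s \<Rightarrow> 'a) \<Rightarrow> 't \<Rightarrow> 'a"
  where "mat_vec F T S \<Phi> X = (\<lambda>i \<in> T. sum_single F S (\<lambda>j. \<Phi> (i, j) \<otimes>\<^bsub>F\<^esub> X j))"

definition mat_mult ::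
    "('a, 'm) pre_idyll_scheme \<Rightarrow> 'u set \<Rightarrow> 't set \<Rightarrow> 's set \<Rightarrow>
      ('u \<times> 't \<Rightarrow> 'a) \<Rightarrow> ('t \<times> 's \<Rightarrow> 'a) \<Rightarrow> 'u \<times> 's \<Rightarrow> 'a"
  where "mat_mult F U T S \<Psi> \<Phi> =
    (\<lambda>(i, k) \<in> U \<times> S. sum_single F T (\<lambda>j. \<Psi> (i, j) \<otimes>\<^bsub>F\<^esub> \<Phi> (j, k)))"

definition mat_id :: "('a, 'm) pre_idyll_scheme \<Rightarrow> 's set \<Rightarrow> 's \<times> 's \<Rightarrow> 'a"
  where "mat_id F S = (\<lambda>(i, j) \<in> S \<times> S. if i = j then \<one>\<^bsub>F\<^esub> else zer F)"

definition matroid_morphism ::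
    "('a, 'm) pre_idyll_scheme \<Rightarrow> ('s, 'a) pre_matroid \<Rightarrow> ('t, 'a) pre_matroid \<Rightarrow>
      ('t \<times> 's \<Rightarrow> 'a) \<Rightarrow> bool"
  where "matroid_morphism F N M \<Phi> \<longleftrightarrow>
    is_matroid F N \<and> is_matroid F M \<and> submonomial F (ground M) (ground N) \<Phi> \<and>
    mat_vec F (ground M) (ground N) \<Phi> ` vectors F N \<subseteq> vectors F M"

definition push_matroid ::
    "('b, 'n) pre_idyll_scheme \<Rightarrow> ('a \<Rightarrow> 'b) \<Rightarrow> ('e, 'a) pre_matroid \<Rightarrow> ('e, 'b) pre_matroid"
  where "push_matroid G f M =
    \<lparr>ground = ground M,
     mrank = mrank M,
     gpclass = (\<Union>\<phi> \<in> gpclass M. gp_class G (ground M) (mrank M)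
                                  (\<lambda>xs \<in> tuples (ground M) (mrank M). f (\<phi> xs)))\<rparr>"

definition push_matrix ::
    "('a \<Rightarrow> 'b) \<Rightarrow> 't set \<Rightarrow> 's set \<Rightarrow> ('t \<times> 's \<Rightarrow> 'a) \<Rightarrow> 't \<times> 's \<Rightarrow> 'b"
  where "push_matrix f T S \<Phi> = (\<lambda>(i, j) \<in> T \<times> S. f (\<Phi> (i, j)))"


section \<open>Categories and functors\<close>

text \<open>\<open>Comp C x y z g h\<close> is the composite of \<open>h : x \<rightarrow> y\<close> followed by \<open>g : y \<rightarrow> z\<close>. Hom sets need not
  be disjoint, so identities and composition take the objects as arguments.\<close>

record ('o, 'h) cat =
  Obj :: "'o set"
  Hom :: "'o \<Rightarrow> 'o \<Rightarrow> 'h set"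
  Id :: "'o \<Rightarrow> 'h"
  Comp :: "'o \<Rightarrow> 'o \<Rightarrow> 'o \<Rightarrow> 'h \<Rightarrow> 'h \<Rightarrow> 'h"

definition is_category :: "('o, 'h) cat \<Rightarrow> bool"
  where "is_category C \<longleftrightarrow>
    (\<forall>x \<in> Obj C. Id C x \<in> Hom C x x) \<and>
    (\<forall>x \<in> Obj C. \<forall>y \<in> Obj C. \<forall>z \<in> Obj C. \<forall>h \<in> Hom C x y. \<forall>g \<in> Hom C y z.
      Comp C x y z g h \<in> Hom C x z) \<and>
    (\<forall>x \<in> Obj C. \<forall>y \<in> Obj C. \<forall>h \<in> Hom C x y.
      Comp C x x y h (Id C x) = h \<and> Comp C x y y (Id C y) h = h) \<and>
    (\<forall>w \<in> Obj C. \<forall>x \<in> Obj C. \<forall>y \<in> Obj C. \<forall>z \<in> Obj C.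
      \<forall>h \<in> Hom C w x. \<forall>g \<in> Hom C x y. \<forall>k \<in> Hom C y z.
      Comp C w x z (Comp C x y z k g) h = Comp C w y z k (Comp C w x y g h))"

definition is_functor ::
    "('o, 'h) cat \<Rightarrow> ('p, 'k) cat \<Rightarrow> ('o \<Rightarrow> 'p) \<Rightarrow> ('o \<Rightarrow> 'o \<Rightarrow> 'h \<Rightarrow> 'k) \<Rightarrow> bool"
  where "is_functor C D Fo Fm \<longleftrightarrow>
    is_category C \<and> is_category D \<and>
    (\<forall>x \<in> Obj C. Fo x \<in> Obj D) \<and>
    (\<forall>x \<in> Obj C. \<forall>y \<in> Obj C. \<forall>h \<in> Hom C x y. Fm x y h \<in> Hom D (Fo x) (Fo y)) \<and>
    (\<forall>x \<in> Obj C. Fm x x (Id C x) = Id D (Fo x)) \<and>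
    (\<forall>x \<in> Obj C. \<forall>y \<in> Obj C. \<forall>z \<in> Obj C. \<forall>h \<in> Hom C x y. \<forall>g \<in> Hom C y z.
      Fm x z (Comp C x y z g h) = Comp D (Fo x) (Fo y) (Fo z) (Fm y z g) (Fm x y h))"

definition Mat :: "('a, 'm) pre_idyll_scheme \<Rightarrow> (('e, 'a) pre_matroid, 'e \<times> 'e \<Rightarrow> 'a) cat"
  where "Mat F =
    \<lparr>Obj = {M. is_matroid F M},
     Hom = (\<lambda>N M. {\<Phi>. matroid_morphism F N M \<Phi>}),
     Id = (\<lambda>M. mat_id F (ground M)),
     Comp = (\<lambda>L N M \<Psi> \<Phi>. mat_mult F (ground M) (ground N) (ground L) \<Psi> \<Phi>)\<rparr>"

end

theory Submission
  imports Defs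
begin

text \<open>
  A morphism \<open>\<Phi> : N \<rightarrow> M\<close> is defined by a condition on vectors, but vectors of \<open>f\<^sub>* N\<close> need not come from
  vectors of \<open>N\<close>, so the condition cannot be pushed forward directly. It can be after passing to the
  transpose, because circuits and cocircuits of \<open>f\<^sub>* M\<close> do come, up to units, from those of \<open>M\<close>.

  Submonomial matrices have adjoints: \<open>\<Phi> X \<bottom> Y\<close> if and only if \<open>X \<bottom> \<Phi>\<^sup>t Y\<close>, since both pairings have
  the same nonzero terms \<open>\<Phi>\<^sub>i\<^sub>j X\<^sub>j Y\<^sub>i\<close> (\<open>orthogonal_adjoint\<close>). Let \<open>Y\<close> be a cocircuit of \<open>M\<close>. Every
  circuit \<open>C\<close> of \<open>N\<close> is a vector of \<open>N\<close>, by the Pluecker relations, hence \<open>\<Phi> C \<bottom> Y\<close> and \<open>C \<bottom> \<Phi>\<^sup>t Y\<close>.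
  So \<open>\<Phi>\<^sup>t Y\<close> is a covector of \<open>N\<close> (\<open>transpose_cocircuit_covector\<close>). Covectors are defined by null sums
  against circuits, and \<open>f\<close> preserves null sums, so \<open>f (\<Phi>\<^sup>t Y) = (f\<^sub>* \<Phi>)\<^sup>t f (Y)\<close> is a covector of
  \<open>f\<^sub>* N\<close> (\<open>covectors_push\<close>). Perfection of \<open>G\<close> makes it orthogonal to every vector \<open>X\<close> of
  \<open>f\<^sub>* N\<close>, and taking the adjoint back gives \<open>(f\<^sub>* \<Phi>) X \<bottom> f (Y)\<close>. The cocircuits of \<open>f\<^sub>* M\<close> are, up to
  units, these \<open>f (Y)\<close>; so \<open>(f\<^sub>* \<Phi>) X\<close> is a vector of \<open>f\<^sub>* M\<close> (\<open>matroid_morphism_push\<close>).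

  Two facts make this work with the definition of cocircuits as circuits of the dual. First, up to a
  unit, the cocircuits of the class of \<open>\<phi>\<close> are the nonzero functions \<open>e \<mapsto> \<phi> (e, x\<^sub>2, \<dots>, x\<^sub>r)\<close>: the
  signs in the dual and in the fundamental circuit cancel except for one sign that does not depend
  on \<open>e\<close> (\<open>fund_circuit_dual_gp\<close>, \<open>vectors_iff\<close>). This description involves no order on the ground
  set, and so is visibly compatible with \<open>f\<^sub>*\<close> and with relabelling. Secondly, relabelling extends
  perfection from ground sets of natural numbers to all finite ground sets
  (\<open>perfect_orthogonal\<close>).

  Functoriality reduces to the fact that a product of submonomial matrices has at most one nonzero
  term in each entry, so that applying \<open>f\<close> entrywise respects it.
\<close>


section \<open>Arithmetic in an idyll\<close>

context idyll
begin

lemma nonzeroD: "a \<in> nonzero F \<Longrightarrow> a \<in> carrier F" "a \<in> nonzero F \<Longrightarrow> a \<noteq> zer F"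
  by (auto simp: nonzero_def)

lemma zer_mult_right: "a \<in> carrier F \<Longrightarrow> a \<otimes> zer F = zer F"
  using zer_mult[of a] m_comm[OF _ zer_closed, of a] by simp

lemma one_nonzero: "\<one> \<in> nonzero F"
  using nonzero_group monoid.one_closed[of "F\<lparr>carrier := nonzero F\<rparr>"]
  by (simp add: comm_group_def comm_monoid_def)

lemma one_neq_zer: "\<one> \<noteq> zer F" "zer F \<noteq> \<one>"
  using one_nonzero by (auto simp: nonzero_def)

lemma mult_nonzero: "a \<in> nonzero F \<Longrightarrow> b \<in> nonzero F \<Longrightarrow> a \<otimes> b \<in> nonzero F"
  using nonzero_group monoid.m_closed[of "F\<lparr>carrier := nonzero F\<rparr>" a b]
  by (simp add: comm_group_def comm_monoid_def)

lemma inverse_exists: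
  assumes "a \<in> nonzero F"
  obtains b where "b \<in> nonzero F" "b \<otimes> a = \<one>"
  using nonzero_group group.l_inv_ex[of "F\<lparr>carrier := nonzero F\<rparr>" a] assms
  by (auto simp: comm_group_def)

lemma mult_eq_zer_iff:
  "a \<in> carrier F \<Longrightarrow> b \<in> carrier F \<Longrightarrow> a \<otimes> b = zer F \<longleftrightarrow> a = zer F \<or> b = zer F"
  using mult_nonzero[of a b] by (auto simp: nonzero_def zer_mult zer_mult_right)

lemma neg_one_nonzero: "neg_one F \<in> nonzero F"
  and one_neg_one_null: "{#\<one>, neg_one F#} \<in> nullset F"
  using theI'[OF ex1_neg_one] by (auto simp: neg_one_def)

lemma neg_one_unique: "e \<in> nonzero F \<Longrightarrow> {#\<one>, e#} \<in> nullset F \<Longrightarrow> e = neg_one F"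
  using ex1_neg_one neg_one_nonzero one_neg_one_null by blast

lemma neg_one_closed: "neg_one F \<in> carrier F"
  using neg_one_nonzero by (rule nonzeroD)

text \<open>Dividing \<open>1 + (-1)\<close> by \<open>-1\<close> shows that the inverse of \<open>-1\<close> is again an additive inverse
  of \<open>1\<close>.\<close>

lemma neg_one_square: "neg_one F \<otimes> neg_one F = \<one>"
proof -
  obtain b where b: "b \<in> nonzero F" "b \<otimes> neg_one F = \<one>"
    using inverse_exists[OF neg_one_nonzero] .
  have "semiring_mult F {#b#} {#\<one>, neg_one F#} \<in> nullset F"
    using b by (intro mult_null one_neg_one_null) auto
  then have "{#\<one>, b#} \<in> nullset F"
    using b by (simp add: semiring_mult_def nonzeroD add_mset_commute)
  with b show ?thesis
    using neg_one_unique by blast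
qed

lemma of_sign_nonzero: "of_sign F s \<in> nonzero F"
  by (simp add: of_sign_def one_nonzero neg_one_nonzero)

lemma of_sign_closed: "of_sign F s \<in> carrier F"
  using of_sign_nonzero by (rule nonzeroD)

lemma of_sign_one: "of_sign F 1 = \<one>"
  by (simp add: of_sign_def)

lemma of_sign_mult:
  assumes "s \<in> {1, -1}" "t \<in> {1, -1}"
  shows "of_sign F (s * t) = of_sign F s \<otimes> of_sign F t"
  using assms by (auto simp: of_sign_def neg_one_square neg_one_closed)

lemma neg_one_pow: "neg_one F [^] k = of_sign F ((-1) ^ k)"
proof (induction k)
  case (Suc k)
  have "(-1::int) ^ k \<in> {1, -1}"
    using neg_one_even_power neg_one_odd_power by (cases "even k") auto
  with of_sign_mult[of "-1" "(-1) ^ k"] of_sign_mult[of "(-1) ^ k" "-1"] show ?case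
    by (simp add: Suc of_sign_def)
qed (simp add: of_sign_one)


section \<open>Null sums\<close>

lemma is_null_replicate_zer: "is_null F (image_mset (\<lambda>_. zer F) A)"
  by (simp add: is_null_def filter_mset_image_mset empty_null)

lemma is_null_scale:
  assumes "a \<in> nonzero F" "set_mset A \<subseteq> carrier F" "is_null F A"
  shows "is_null F (image_mset (\<lambda>x. a \<otimes> x) A)"
proof -
  have "{#b \<in># image_mset (\<lambda>x. a \<otimes> x) A. b \<noteq> zer F#} =
        image_mset (\<lambda>x. a \<otimes> x) {#b \<in># A. b \<noteq> zer F#}"
    unfolding filter_mset_image_mset o_def
    using assms by (intro arg_cong[where f = "image_mset _"] filter_mset_cong refl)
      (auto simp: mult_eq_zer_iff nonzero_def)
  also have "\<dots> = semiring_mult F {#a#} {#b \<in># A. b \<noteq> zer F#}"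
    by (simp add: semiring_mult_def)
  also have "\<dots> \<in> nullset F"
    using assms by (intro mult_null) (auto simp: is_null_def)
  finally show ?thesis
    by (simp add: is_null_def)
qed

lemma is_null_scale_iff:
  assumes "a \<in> nonzero F" "set_mset A \<subseteq> carrier F"
  shows "is_null F (image_mset (\<lambda>x. a \<otimes> x) A) \<longleftrightarrow> is_null F A"
proof
  assume null: "is_null F (image_mset (\<lambda>x. a \<otimes> x) A)"
  obtain b where b: "b \<in> nonzero F" "b \<otimes> a = \<one>"
    using inverse_exists[OF assms(1)] .
  have "is_null F (image_mset (\<lambda>x. b \<otimes> x) (image_mset (\<lambda>x. a \<otimes> x) A))"
    by (rule is_null_scale[OF b(1) _ null]) (use assms in \<open>auto simp: nonzero_def\<close>)
  also have "image_mset (\<lambda>x. b \<otimes> x) (image_mset (\<lambda>x. a \<otimes> x) A) = image_mset (\<lambda>x. x) A"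
    unfolding multiset.map_comp o_def using assms b
    by (intro image_mset_cong) (auto simp: nonzero_def m_assoc[symmetric] subset_iff)
  finally show "is_null F A"
    by simp
qed (use assms is_null_scale in blast)

lemma is_null_support:
  assumes "finite I"
  shows "is_null F {#h i. i \<in># mset_set I#} \<longleftrightarrow>
    {#h i. i \<in># mset_set {i \<in> I. h i \<noteq> zer F}#} \<in> nullset F"
  using assms by (simp add: is_null_def filter_mset_image_mset o_def)

text \<open>Only the nonzero terms of a sum matter, so a sum may be reindexed by any injection that
  reaches all of them.\<close>

lemma is_null_reindex:
  assumes "finite I" "inj_on p J" "p ` J \<subseteq> I" "\<And>i. i \<in> I \<Longrightarrow> h i \<noteq> zer F \<Longrightarrow> i \<in> p ` J"
  shows "is_null F {#h i. i \<in># mset_set I#} \<longleftrightarrow> is_null F {#h (p j). j \<in># mset_set J#}"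
proof -
  have fin: "finite J"
    using assms finite_imageD finite_subset by blast
  have eq: "{i \<in> I. h i \<noteq> zer F} = p ` {j \<in> J. h (p j) \<noteq> zer F}"
    using assms(3,4) by fast
  have "inj_on p {j \<in> J. h (p j) \<noteq> zer F}"
    using assms(2) by (rule inj_on_subset) auto
  then have "{#h i. i \<in># mset_set {i \<in> I. h i \<noteq> zer F}#} =
             {#h (p j). j \<in># mset_set {j \<in> J. h (p j) \<noteq> zer F}#}"
    unfolding eq by (simp add: image_mset_mset_set[symmetric] multiset.map_comp o_def)
  then show ?thesis
    using is_null_support[OF assms(1)] is_null_support[OF fin, of "\<lambda>j. h (p j)"] by simp
qed

lemma orthogonal_scale:
  assumes "a \<in> nonzero F" "finite E" "X \<in> E \<rightarrow> carrier F" "Y \<in> E \<rightarrow> carrier F"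
    and "\<And>e. e \<in> E \<Longrightarrow> Z e = a \<otimes> Y e"
  shows "orthogonal F E X Z \<longleftrightarrow> orthogonal F E X Y"
proof -
  have "{#X e \<otimes> Z e. e \<in># mset_set E#} = image_mset (\<lambda>x. a \<otimes> x) {#X e \<otimes> Y e. e \<in># mset_set E#}"
    unfolding multiset.map_comp o_def using assms
    by (intro image_mset_cong) (auto simp: nonzero_def Pi_iff m_lcomm)
  moreover have "set_mset {#X e \<otimes> Y e. e \<in># mset_set E#} \<subseteq> carrier F"
    using assms by auto
  ultimately show ?thesis
    using is_null_scale_iff assms by (simp add: orthogonal_def)
qed

lemma orthogonal_zer:
  assumes "finite E" "X \<in> E \<rightarrow> carrier F" "\<And>e. e \<in> E \<Longrightarrow> Z e = zer F"
  shows "orthogonal F E X Z"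
proof -
  have "{#X e \<otimes> Z e. e \<in># mset_set E#} = {#zer F. e \<in># mset_set E#}"
    using assms by (intro image_mset_cong) (simp add: zer_mult_right Pi_iff)
  then show ?thesis
    using is_null_replicate_zer by (simp add: orthogonal_def)
qed

end

section \<open>Sorting signs\<close>

lemma distinct_enum: "finite A \<Longrightarrow> distinct (enum A) \<and> set (enum A) = A"
  unfolding enum_def by (rule someI_ex) (use finite_distinct_list in blast)

lemma distinct_permute_list_inject:
  assumes "distinct zs" "\<sigma> permutes {..<length zs}" "\<tau> permutes {..<length zs}"
    and "permute_list \<sigma> zs = permute_list \<tau> zs"
  shows "\<sigma> = \<tau>"
proof
  fix i
  show "\<sigma> i = \<tau> i"
  proof (cases "i < length zs")
    case True
    with assms have "zs ! \<sigma> i = zs ! \<tau> i"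
      by (metis permute_list_nth)
    moreover have "\<sigma> i < length zs" "\<tau> i < length zs"
      using True assms permutes_in_image[of _ "{..<length zs}"] by (metis lessThan_iff)+
    ultimately show ?thesis
      using assms(1) nth_eq_iff_index_eq by blast
  next
    case False
    with assms show ?thesis
      by (metis lessThan_iff permutes_not_in)
  qed
qed

lemma sorting_sign_eq:
  assumes "distinct zs" "\<sigma> permutes {..<length zs}" "permute_list \<sigma> zs = enum E"
  shows "sorting_sign E zs = sign \<sigma>"
proof -
  have "(THE \<sigma>. \<sigma> permutes {..<length zs} \<and> permute_list \<sigma> zs = enum E) = \<sigma>"
    using assms by (intro the_equality) (auto intro: distinct_permute_list_inject)
  then show ?thesis
    by (simp add: sorting_sign_def)
qed

lemma sorting_sign_cases: "sorting_sign E zs \<in> {1, -1}"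
  using sign_cases by (auto simp: sorting_sign_def)

text \<open>If \<open>\<sigma>\<close> sorts \<open>permute_list \<tau> zs\<close>, then \<open>\<tau> \<circ> \<sigma>\<close> sorts \<open>zs\<close>.\<close>

lemma sorting_sign_permute_list:
  assumes "distinct zs" "\<tau> permutes {..<length zs}"
  shows "sorting_sign (set zs) (permute_list \<tau> zs) = sign \<tau> * sorting_sign (set zs) zs"
proof -
  have "mset (enum (set zs)) = mset (permute_list \<tau> zs)"
    using distinct_enum[of "set zs"] assms by (metis List.finite_set mset_permute_list set_eq_iff_mset_eq_distinct)
  then obtain \<sigma> where "\<sigma> permutes {..<length (permute_list \<tau> zs)}"
      "permute_list \<sigma> (permute_list \<tau> zs) = enum (set zs)"
    using mset_eq_permutation by metis
  then have \<sigma>: "\<sigma> permutes {..<length zs}" "permute_list \<sigma> (permute_list \<tau> zs) = enum (set zs)"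
    by simp_all
  have "sorting_sign (set zs) (permute_list \<tau> zs) = sign \<sigma>"
    using assms \<sigma> by (intro sorting_sign_eq) auto
  moreover have "sorting_sign (set zs) zs = sign (\<tau> \<circ> \<sigma>)"
    using assms \<sigma> by (intro sorting_sign_eq) (auto simp: permute_list_compose permutes_compose)
  moreover have "sign (\<tau> \<circ> \<sigma>) = sign \<tau> * sign \<sigma>"
    using assms \<sigma> permutation_permutes by (intro sign_compose) blast+
  ultimately show ?thesis
    by simp
qed

lemma permute_list_transpose_append:
  assumes "a < length bs" "b < length bs"
  shows "permute_list (transpose (length as + a) (length as + b)) (as @ bs) =
    as @ permute_list (transpose a b) bs"
proof (rule nth_equalityI)
  fix i
  assume "i < length (permute_list (transpose (length as + a) (length as + b)) (as @ bs))"
  then have i: "i < length as + length bs"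
    by simp
  have "transpose (length as + a) (length as + b) permutes {..<length (as @ bs)}"
    "transpose a b permutes {..<length bs}"
    using assms by (auto intro!: permutes_swap_id)
  with i show "permute_list (transpose (length as + a) (length as + b)) (as @ bs) ! i =
      (as @ permute_list (transpose a b) bs) ! i"
    by (cases "i < length as") (auto simp: permute_list_nth nth_append transpose_def)
qed simp

text \<open>Induction on a factorisation of \<open>\<tau>\<close> into transpositions: a transposition of two entries of the
  suffix is a transposition of two entries of the whole list.\<close>

lemma sorting_sign_permute_suffix:
  assumes "distinct (as @ bs)" "set (as @ bs) = E" "\<tau> permutes {..<length bs}"
  shows "sorting_sign E (as @ permute_list \<tau> bs) = sign \<tau> * sorting_sign E (as @ bs)"
  using finite_lessThan assms(3)
proof (induction rule: permutes_rev_induct)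
  case id
  then show ?case by simp
next
  case (swap a b \<sigma>)
  let ?cs = "permute_list \<sigma> bs" and ?t = "transpose (length as + a) (length as + b)"
  have t: "transpose a b permutes {..<length bs}" "?t permutes {..<length (as @ ?cs)}"
    using swap by (auto intro!: permutes_swap_id)
  have "as @ permute_list (\<sigma> \<circ> transpose a b) bs = permute_list ?t (as @ ?cs)"
    using permute_list_transpose_append[of a ?cs b as] swap.hyps t by (simp add: permute_list_compose)
  moreover have "distinct (as @ ?cs)" "set (as @ ?cs) = E"
    using assms swap.hyps by auto
  ultimately have "sorting_sign E (as @ permute_list (\<sigma> \<circ> transpose a b) bs) =
      sign ?t * sorting_sign E (as @ ?cs)"
    using sorting_sign_permute_list t by metis
  moreover have "sign ?t = -1" "sign (transpose a b) = -1"
    using swap.hyps by (simp_all add: sign_swap_id)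
  moreover have "permutation \<sigma>"
    using swap.hyps permutation_permutes by blast
  then have "sign (\<sigma> \<circ> transpose a b) = sign \<sigma> * sign (transpose a b)"
    by (intro sign_compose permutation_swap_id)
  ultimately show ?case
    using swap.IH by (simp add: o_def)
qed

lemma sorting_sign_swap:
  assumes "distinct (us @ a # b # vs)" "set (us @ a # b # vs) = E"
  shows "sorting_sign E (us @ b # a # vs) = - sorting_sign E (us @ a # b # vs)"
proof -
  let ?t = "transpose (0::nat) 1"
  have t: "?t permutes {..<length (a # b # vs)}"
    by (intro permutes_swap_id) auto
  have "permute_list ?t (a # b # vs) = b # a # vs"
  proof (rule nth_equalityI)
    fix i
    assume "i < length (permute_list ?t (a # b # vs))"
    then show "permute_list ?t (a # b # vs) ! i = (b # a # vs) ! i"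
      using t by (cases i; cases "i - 1") (auto simp: permute_list_nth transpose_def)
  qed simp
  with sorting_sign_permute_suffix[OF assms t] show ?thesis
    by (simp add: sign_swap_id)
qed

text \<open>Each entry of \<open>vs\<close> that \<open>a\<close> passes contributes one adjacent swap.\<close>

lemma sorting_sign_move:
  assumes "distinct (us @ a # vs @ xs)" "set (us @ a # vs @ xs) = E"
  shows "sorting_sign E (us @ vs @ a # xs) = (-1) ^ length vs * sorting_sign E (us @ a # vs @ xs)"
  using assms
proof (induction vs arbitrary: us)
  case (Cons c vs)
  have "sorting_sign E (us @ c # vs @ a # xs) =
      (-1) ^ length vs * sorting_sign E (us @ c # a # vs @ xs)"
    using Cons.IH[of "us @ [c]"] Cons.prems by (auto simp: insert_commute)
  with sorting_sign_swap[of us a c "vs @ xs"] Cons.prems show ?case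
    by simp
qed simp

section \<open>Circuits and vectors from one Grassmann--Pluecker function\<close>

lemma set_omit:
  assumes "distinct ys" "i < length ys"
  shows "set (omit i ys) = set ys - {ys ! i}" "distinct (omit i ys)"
proof -
  have "ys = take i ys @ ys ! i # drop (Suc i) ys"
    using assms by (simp add: id_take_nth_drop)
  then have "distinct (take i ys @ ys ! i # drop (Suc i) ys)"
      "set ys = set (take i ys @ ys ! i # drop (Suc i) ys)"
    using assms by metis+
  then show "set (omit i ys) = set ys - {ys ! i}" "distinct (omit i ys)"
    by (auto simp: omit_def)
qed

lemma omit_tuples: "ys \<in> tuples E (Suc r) \<Longrightarrow> k \<le> r \<Longrightarrow> omit k ys \<in> tuples E r"
  by (auto simp: tuples_def omit_def dest: in_set_takeD in_set_dropD)

context idyll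
begin

lemma gp_closed: "grassmann_pluecker F E r \<phi> \<Longrightarrow> \<phi> \<in> tuples E r \<rightarrow> carrier F"
  by (auto simp: grassmann_pluecker_def PiE_iff)

lemma gp_permute:
  "grassmann_pluecker F E r \<phi> \<Longrightarrow> xs \<in> tuples E r \<Longrightarrow> \<sigma> permutes {..<r} \<Longrightarrow>
    \<phi> (permute_list \<sigma> xs) = of_sign F (sign \<sigma>) \<otimes> \<phi> xs"
  by (auto simp: grassmann_pluecker_def)

lemma gp_not_distinct:
  "grassmann_pluecker F E r \<phi> \<Longrightarrow> xs \<in> tuples E r \<Longrightarrow> \<not> distinct xs \<Longrightarrow> \<phi> xs = zer F"
  by (auto simp: grassmann_pluecker_def)

lemma gp_null:
  "grassmann_pluecker F E r \<phi> \<Longrightarrow> set xs \<subseteq> E \<Longrightarrow> Suc (length xs) = r \<Longrightarrow> ys \<in> tuples E (Suc r) \<Longrightarrow>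
    is_null F {#neg_one F [^] k \<otimes> \<phi> (omit k ys) \<otimes> \<phi> (ys ! k # xs). k \<in># mset_set {0..r}#}"
  unfolding grassmann_pluecker_def by blast

lemma gp_rank_le:
  assumes "grassmann_pluecker F E r \<phi>" "finite E"
  shows "r \<le> card E"
proof -
  obtain xs where "xs \<in> tuples E r" "\<phi> xs \<noteq> zer F"
    using assms by (auto simp: grassmann_pluecker_def)
  then have "distinct xs" "set xs \<subseteq> E" "length xs = r"
    using gp_not_distinct[OF assms(1)] by (auto simp: tuples_def)
  then show ?thesis
    using card_mono[OF assms(2)] distinct_card by metis
qed

lemma gp_class_scale:
  assumes "a \<in> nonzero F" "\<phi> \<in> tuples E r \<rightarrow> carrier F"
  shows "gp_class F E r (\<lambda>xs\<in>tuples E r. a \<otimes> \<phi> xs) = gp_class F E r \<phi>"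
proof (intro equalityI subsetI)
  fix \<psi>
  assume "\<psi> \<in> gp_class F E r (\<lambda>xs\<in>tuples E r. a \<otimes> \<phi> xs)"
  then obtain b where b: "b \<in> nonzero F"
      "\<psi> = (\<lambda>xs\<in>tuples E r. b \<otimes> (\<lambda>xs\<in>tuples E r. a \<otimes> \<phi> xs) xs)"
    by (auto simp: gp_class_def)
  have "\<psi> = (\<lambda>xs\<in>tuples E r. (b \<otimes> a) \<otimes> \<phi> xs)"
    unfolding b(2) using assms b(1) by (intro restrict_ext) (auto simp: m_assoc nonzero_def Pi_iff)
  then show "\<psi> \<in> gp_class F E r \<phi>"
    using mult_nonzero[OF b(1) assms(1)] by (auto simp: gp_class_def)
next
  fix \<psi>
  assume "\<psi> \<in> gp_class F E r \<phi>"
  then obtain b where b: "b \<in> nonzero F" "\<psi> = (\<lambda>xs\<in>tuples E r. b \<otimes> \<phi> xs)"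
    by (auto simp: gp_class_def)
  obtain c where c: "c \<in> nonzero F" "c \<otimes> a = \<one>"
    using inverse_exists[OF assms(1)] .
  have "\<psi> = (\<lambda>xs\<in>tuples E r. (b \<otimes> c) \<otimes> (\<lambda>xs\<in>tuples E r. a \<otimes> \<phi> xs) xs)"
    unfolding b(2)
  proof (intro restrict_ext)
    fix xs
    assume xs: "xs \<in> tuples E r"
    have carr: "\<phi> xs \<in> carrier F" "a \<in> carrier F" "b \<in> carrier F" "c \<in> carrier F"
      using assms b c xs by (auto simp: nonzero_def)
    have "(b \<otimes> c) \<otimes> (a \<otimes> \<phi> xs) = b \<otimes> ((c \<otimes> a) \<otimes> \<phi> xs)"
      using carr by (simp add: m_assoc)
    with c carr xs show "b \<otimes> \<phi> xs = (b \<otimes> c) \<otimes> (\<lambda>xs\<in>tuples E r. a \<otimes> \<phi> xs) xs"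
      by simp
  qed
  then show "\<psi> \<in> gp_class F E r (\<lambda>xs\<in>tuples E r. a \<otimes> \<phi> xs)"
    using mult_nonzero[OF b(1) c(1)] by (auto simp: gp_class_def)
qed

text \<open>Operations on classes are unions over all representatives. If changing the representative only
  scales the result, then one representative suffices.\<close>

lemma UN_gp_class:
  assumes "\<psi> \<in> tuples E' r' \<rightarrow> carrier F" "A \<noteq> {}"
    and "\<And>\<phi>. \<phi> \<in> A \<Longrightarrow> \<exists>a \<in> nonzero F. T \<phi> = (\<lambda>xs\<in>tuples E' r'. a \<otimes> \<psi> xs)"
  shows "(\<Union>\<phi>\<in>A. gp_class F E' r' (T \<phi>)) = gp_class F E' r' \<psi>"
proof -
  have "gp_class F E' r' (T \<phi>) = gp_class F E' r' \<psi>" if "\<phi> \<in> A" for \<phi>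
    using assms(3)[OF that] gp_class_scale[OF _ assms(1)] by auto
  with assms(2) show ?thesis
    by auto
qed

lemma gp_class_nonempty: "gp_class F E r \<phi> \<noteq> {}"
  using one_nonzero by (auto simp: gp_class_def)

lemma fund_circuit_nth:
  assumes "set ys \<subseteq> E" "distinct ys" "i < length ys"
  shows "fund_circuit F E \<phi> ys (ys ! i) = neg_one F [^] i \<otimes> \<phi> (omit i ys)"
proof -
  have "(THE j. j < length ys \<and> ys ! j = ys ! i) = i"
    using assms nth_eq_iff_index_eq by (intro the_equality) auto
  moreover have "ys ! i \<in> E"
    using assms by auto
  ultimately show ?thesis
    using assms by (simp add: fund_circuit_def Let_def)
qed

lemma fund_circuit_outside: "e \<in> E \<Longrightarrow> e \<notin> set ys \<Longrightarrow> fund_circuit F E \<phi> ys e = zer F"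
  by (simp add: fund_circuit_def)

lemma fund_circuit_closed:
  assumes "\<phi> \<in> tuples E r \<rightarrow> carrier F" "ys \<in> tuples E (Suc r)" "distinct ys"
  shows "fund_circuit F E \<phi> ys \<in> E \<rightarrow>\<^sub>E carrier F"
proof (rule PiE_I)
  fix e
  assume "e \<in> E"
  show "fund_circuit F E \<phi> ys e \<in> carrier F"
  proof (cases "e \<in> set ys")
    case True
    then obtain i where "i < length ys" "e = ys ! i"
      by (metis in_set_conv_nth)
    then show ?thesis
      using assms omit_tuples[OF assms(2), of i] fund_circuit_nth[of ys E i \<phi>] neg_one_closed
      by (auto simp: tuples_def)
  next
    case False
    with \<open>e \<in> E\<close> show ?thesis
      by (simp add: fund_circuit_outside zer_closed)
  qed
qed (simp add: fund_circuit_def)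

lemma fund_circuit_scale:
  assumes "\<phi> \<in> tuples E r \<rightarrow> carrier F" "ys \<in> tuples E (Suc r)" "distinct ys"
    and "e \<in> E" "a \<in> carrier F"
  shows "fund_circuit F E (\<lambda>xs\<in>tuples E r. a \<otimes> \<phi> xs) ys e = a \<otimes> fund_circuit F E \<phi> ys e"
proof (cases "e \<in> set ys")
  case True
  then obtain i where i: "i < length ys" "e = ys ! i"
    by (metis in_set_conv_nth)
  then have om: "omit i ys \<in> tuples E r"
    using assms(2) by (intro omit_tuples) (auto simp: tuples_def)
  then have "\<phi> (omit i ys) \<in> carrier F"
    using assms(1) by blast
  then show ?thesis
    using assms(2,3,5) i om fund_circuit_nth[of ys E i]
    by (simp add: tuples_def m_lcomm neg_one_closed)
next
  case False
  with assms show ?thesis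
    by (simp add: fund_circuit_outside zer_mult_right)
qed

text \<open>A circuit is a unit multiple of a nonzero fundamental circuit of any one representative, and
  a vanishing fundamental circuit is orthogonal to everything.\<close>

lemma orthogonal_circuits_iff:
  assumes "finite (ground M)" "gpclass M = gp_class F (ground M) (mrank M) \<phi>"
    and "\<phi> \<in> tuples (ground M) (mrank M) \<rightarrow> carrier F" "X \<in> ground M \<rightarrow> carrier F"
  shows "(\<forall>Y \<in> circuits F M. orthogonal F (ground M) X Y) \<longleftrightarrow>
    (\<forall>ys \<in> tuples (ground M) (Suc (mrank M)). distinct ys \<longrightarrow>
      orthogonal F (ground M) X (fund_circuit F (ground M) \<phi> ys))"
    (is "?l \<longleftrightarrow> ?r")
proof
  assume ?l
  show ?r
  proof (intro ballI impI)
    fix ys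
    assume ys: "ys \<in> tuples (ground M) (Suc (mrank M))" "distinct ys"
    \<comment> \<open>The class consists of restricted multiples, so \<open>\<phi>\<close> itself, which need not be extensional, is
      replaced by its multiple by \<open>\<one>\<close>.\<close>
    let ?\<phi> = "\<lambda>xs\<in>tuples (ground M) (mrank M). \<one> \<otimes> \<phi> xs"
    let ?Y = "\<lambda>e\<in>ground M. \<one> \<otimes> fund_circuit F (ground M) ?\<phi> ys e"
    note closed = fund_circuit_closed[OF assms(3) ys]
    show "orthogonal F (ground M) X (fund_circuit F (ground M) \<phi> ys)"
    proof (cases "\<exists>k \<le> mrank M. \<phi> (omit k ys) \<noteq> zer F")
      case True
      then have "\<exists>k \<le> mrank M. ?\<phi> (omit k ys) \<noteq> zer F"
        using assms(3) omit_tuples[OF ys(1)] by (fastforce simp: Pi_iff)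
      moreover have "?\<phi> \<in> gpclass M"
        using one_nonzero by (auto simp: assms(2) gp_class_def)
      ultimately have "?Y \<in> circuits F M"
        unfolding circuits_def mem_Collect_eq using one_nonzero ys
        by (intro exI[of _ \<one>] exI[of _ ?\<phi>] exI[of _ ys]) blast
      with \<open>?l\<close> have "orthogonal F (ground M) X ?Y"
        by blast
      moreover have "?Y e = \<one> \<otimes> fund_circuit F (ground M) \<phi> ys e" if "e \<in> ground M" for e
        using that closed fund_circuit_scale[OF assms(3) ys, of e \<one>] by (auto simp: PiE_iff)
      ultimately show ?thesis
        using orthogonal_scale[OF one_nonzero assms(1,4), of "fund_circuit F (ground M) \<phi> ys" ?Y]
          closed by (auto simp: PiE_iff)
    next
      case False
      have "fund_circuit F (ground M) \<phi> ys e = zer F" if e: "e \<in> ground M" for e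
      proof (cases "e \<in> set ys")
        case True
        then obtain i where "i < length ys" "e = ys ! i"
          by (metis in_set_conv_nth)
        then show ?thesis
          using False ys fund_circuit_nth[of ys "ground M" i \<phi>]
          by (auto simp: tuples_def zer_mult_right neg_one_closed)
      qed (simp add: fund_circuit_outside e)
      then show ?thesis
        using orthogonal_zer[OF assms(1,4)] by blast
    qed
  qed
next
  assume r: ?r
  show ?l
  proof
    fix Y
    assume "Y \<in> circuits F M"
    then obtain a b ys where Y: "Y = (\<lambda>e\<in>ground M. a \<otimes> fund_circuit F (ground M)
          (\<lambda>xs\<in>tuples (ground M) (mrank M). b \<otimes> \<phi> xs) ys e)"
        and ab: "a \<in> nonzero F" "b \<in> nonzero F"
        and ys: "ys \<in> tuples (ground M) (Suc (mrank M))" "distinct ys"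
      unfolding circuits_def assms(2) gp_class_def by blast
    note closed = fund_circuit_closed[OF assms(3) ys]
    have "Y e = (a \<otimes> b) \<otimes> fund_circuit F (ground M) \<phi> ys e" if "e \<in> ground M" for e
      using that closed fund_circuit_scale[OF assms(3) ys, of e b] ab
      by (auto simp: PiE_iff Y nonzero_def m_assoc)
    moreover have "fund_circuit F (ground M) \<phi> ys \<in> ground M \<rightarrow> carrier F"
      using closed by blast
    ultimately show "orthogonal F (ground M) X Y"
      using orthogonal_scale[OF mult_nonzero[OF ab] assms(1,4)] r ys by blast
  qed
qed

lemma orthogonal_commute:
  assumes "finite E" "X \<in> E \<rightarrow> carrier F" "Y \<in> E \<rightarrow> carrier F"
  shows "orthogonal F E X Y \<longleftrightarrow> orthogonal F E Y X"
proof -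
  have "{#X e \<otimes> Y e. e \<in># mset_set E#} = {#Y e \<otimes> X e. e \<in># mset_set E#}"
    using assms by (intro image_mset_cong) (simp add: Pi_iff m_comm)
  then show ?thesis
    by (simp add: orthogonal_def)
qed

text \<open>This is the form in which fundamental circuits meet the Pluecker relations: for
  \<open>X e = \<phi> (e # xs)\<close> the sum is the left-hand side of such a relation.\<close>

lemma orthogonal_fund_circuit_iff:
  assumes "finite E" "\<phi> \<in> tuples E r \<rightarrow> carrier F" "X \<in> E \<rightarrow> carrier F"
    and "ys \<in> tuples E (Suc r)" "distinct ys"
  shows "orthogonal F E X (fund_circuit F E \<phi> ys) \<longleftrightarrow>
    is_null F {#neg_one F [^] k \<otimes> \<phi> (omit k ys) \<otimes> X (ys ! k). k \<in># mset_set {0..r}#}"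
proof -
  have len: "length ys = Suc r" and sub: "set ys \<subseteq> E"
    using assms(4) by (auto simp: tuples_def)
  have img: "(!) ys ` {0..r} = set ys"
    using len by (auto simp: set_conv_nth less_Suc_eq_le)
  have "is_null F {#X e \<otimes> fund_circuit F E \<phi> ys e. e \<in># mset_set E#} \<longleftrightarrow>
      is_null F {#X (ys ! k) \<otimes> fund_circuit F E \<phi> ys (ys ! k). k \<in># mset_set {0..r}#}"
  proof (rule is_null_reindex)
    show "inj_on ((!) ys) {0..r}"
      using assms(5) len by (intro inj_on_nth) auto
    show "(!) ys ` {0..r} \<subseteq> E"
      using img sub by simp
    show "e \<in> (!) ys ` {0..r}"
      if "e \<in> E" "X e \<otimes> fund_circuit F E \<phi> ys e \<noteq> zer F" for e
    proof (rule ccontr)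
      assume "\<not> ?thesis"
      then have "fund_circuit F E \<phi> ys e = zer F"
        using img fund_circuit_outside[of e E ys \<phi>] that(1) by simp
      with that assms(3) show False
        by (auto simp: zer_mult_right Pi_iff)
    qed
  qed (use assms in auto)
  also have "{#X (ys ! k) \<otimes> fund_circuit F E \<phi> ys (ys ! k). k \<in># mset_set {0..r}#} =
      {#neg_one F [^] k \<otimes> \<phi> (omit k ys) \<otimes> X (ys ! k). k \<in># mset_set {0..r}#}"
  proof (intro image_mset_cong)
    fix k
    assume "k \<in># mset_set {0..r}"
    then have k: "k \<le> r" by simp
    then have "ys ! k \<in> E"
      using sub len nth_mem[of k ys] by auto
    then have "X (ys ! k) \<in> carrier F"
      using assms(3) by blast
    moreover have "\<phi> (omit k ys) \<in> carrier F"
      using omit_tuples[OF assms(4) k] assms(2) by blast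
    ultimately show "X (ys ! k) \<otimes> fund_circuit F E \<phi> ys (ys ! k) =
        neg_one F [^] k \<otimes> \<phi> (omit k ys) \<otimes> X (ys ! k)"
      using k fund_circuit_nth[OF sub assms(5), of k] len by (simp add: neg_one_closed m_comm)
  qed
  finally show ?thesis
    by (simp add: orthogonal_def)
qed

lemma covectors_iff:
  assumes "finite (ground M)" "grassmann_pluecker F (ground M) (mrank M) \<phi>"
    and "gpclass M = gp_class F (ground M) (mrank M) \<phi>"
  shows "Y \<in> covectors F M \<longleftrightarrow> Y \<in> ground M \<rightarrow>\<^sub>E carrier F \<and>
    (\<forall>ys \<in> tuples (ground M) (Suc (mrank M)). distinct ys \<longrightarrow>
      is_null F {#neg_one F [^] k \<otimes> \<phi> (omit k ys) \<otimes> Y (ys ! k). k \<in># mset_set {0..mrank M}#})"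
  using orthogonal_circuits_iff[OF assms(1,3) gp_closed[OF assms(2)], of Y]
    orthogonal_fund_circuit_iff[OF assms(1) gp_closed[OF assms(2)], of Y]
  by (auto simp: covectors_def PiE_def)


section \<open>Cocircuits\<close>

lemma enum_complement_tuples:
  assumes "finite E" "r \<le> card E" "xs \<in> tuples E (card E - r)" "distinct xs"
  shows "enum (E - set xs) \<in> tuples E r"
proof -
  have "distinct (enum (E - set xs))" "set (enum (E - set xs)) = E - set xs"
    using distinct_enum[of "E - set xs"] assms(1) by auto
  then have "length (enum (E - set xs)) = card (E - set xs)"
    using distinct_card by metis
  also have "\<dots> = r"
    using assms by (simp add: tuples_def card_Diff_subset distinct_card)
  finally show ?thesis
    using \<open>set (enum (E - set xs)) = E - set xs\<close> by (auto simp: tuples_def)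
qed

lemma dual_gp_closed:
  assumes "finite E" "grassmann_pluecker F E r \<phi>"
  shows "dual_gp F E r \<phi> \<in> tuples E (card E - r) \<rightarrow> carrier F"
proof -
  have "\<phi> (enum (E - set xs)) \<in> carrier F" if "xs \<in> tuples E (card E - r)" "distinct xs" for xs
    using enum_complement_tuples[OF assms(1) gp_rank_le[OF assms(2,1)] that] gp_closed[OF assms(2)]
    by blast
  then show ?thesis
    by (auto simp: dual_gp_def Let_def zer_closed of_sign_closed)
qed

lemma gpclass_dual:
  assumes "finite (ground M)" "grassmann_pluecker F (ground M) (mrank M) \<phi>"
    and "gpclass M = gp_class F (ground M) (mrank M) \<phi>"
  shows "gpclass (dual F M) = gp_class F (ground M) (card (ground M) - mrank M)
    (dual_gp F (ground M) (mrank M) \<phi>)"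
proof -
  let ?E = "ground M" and ?r = "mrank M"
  have scale: "dual_gp F ?E ?r (\<lambda>xs\<in>tuples ?E ?r. a \<otimes> \<phi> xs) =
      (\<lambda>xs\<in>tuples ?E (card ?E - ?r). a \<otimes> dual_gp F ?E ?r \<phi> xs)" if "a \<in> nonzero F" for a
    unfolding dual_gp_def
  proof (intro restrict_ext)
    fix xs
    assume xs: "xs \<in> tuples ?E (card ?E - ?r)"
    have "enum (?E - set xs) \<in> tuples ?E ?r" if "distinct xs"
      using enum_complement_tuples[OF assms(1) gp_rank_le[OF assms(2,1)] xs] that .
    then show "(if distinct xs
        then let xs' = enum (?E - set xs)
             in of_sign F (sorting_sign ?E (xs @ xs')) \<otimes> (\<lambda>xs\<in>tuples ?E ?r. a \<otimes> \<phi> xs) xs'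
        else zer F) =
      a \<otimes> (\<lambda>xs\<in>tuples ?E (card ?E - ?r). if distinct xs
        then let xs' = enum (?E - set xs)
             in of_sign F (sorting_sign ?E (xs @ xs')) \<otimes> \<phi> xs'
        else zer F) xs"
      using xs gp_closed[OF assms(2)] that
      by (auto simp: Let_def of_sign_closed nonzero_def m_lcomm zer_mult_right Pi_iff)
  qed
  have "(\<Union>\<psi>\<in>gp_class F ?E ?r \<phi>. gp_class F ?E (card ?E - ?r) (dual_gp F ?E ?r \<psi>)) =
      gp_class F ?E (card ?E - ?r) (dual_gp F ?E ?r \<phi>)"
  proof (rule UN_gp_class[OF dual_gp_closed[OF assms(1,2)] gp_class_nonempty])
    fix \<psi>
    assume "\<psi> \<in> gp_class F ?E ?r \<phi>"
    then obtain a where "a \<in> nonzero F" "\<psi> = (\<lambda>xs\<in>tuples ?E ?r. a \<otimes> \<phi> xs)"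
      unfolding gp_class_def by blast
    with scale show "\<exists>a\<in>nonzero F. dual_gp F ?E ?r \<psi> =
        (\<lambda>xs\<in>tuples ?E (card ?E - ?r). a \<otimes> dual_gp F ?E ?r \<phi> xs)"
      by blast
  qed
  then show ?thesis
    by (simp add: dual_def assms(3))
qed

text \<open>Write \<open>e = ys ! i\<close>, with \<open>m + 1\<close> the length of \<open>ys\<close>, so that \<open>m = card E - r\<close>. The entry at \<open>e\<close> is
  \<open>(-1)\<^sup>i\<close> times the dual function at \<open>omit i ys\<close>. The complement of \<open>omit i ys\<close> may be listed as
  \<open>e # xs\<close>, as the sign of this reordering occurs twice, and moving \<open>e\<close> back to position \<open>i\<close> of \<open>ys\<close>
  costs \<open>(-1)\<close> to the power \<open>m - i\<close>. Altogether the sign is \<open>(-1)\<^sup>m\<close> times the sorting sign of \<open>ys @ xs\<close>,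
  which is the same for all \<open>e\<close>. At \<open>e\<close> outside \<open>ys\<close> both sides vanish, since then \<open>e\<close> occurs in
  \<open>xs\<close>.\<close>

lemma fund_circuit_dual_gp:
  assumes "finite E" "grassmann_pluecker F E r \<phi>"
    and "distinct (ys @ xs)" "set (ys @ xs) = E" "Suc (length xs) = r" "e \<in> E"
  shows "fund_circuit F E (dual_gp F E r \<phi>) ys e =
    of_sign F ((-1) ^ (card E - r) * sorting_sign E (ys @ xs)) \<otimes> \<phi> (e # xs)"
proof (cases "e \<in> set ys")
  case False
  with assms have "\<not> distinct (e # xs)" "e # xs \<in> tuples E r"
    by (auto simp: tuples_def)
  then show ?thesis
    using False assms(6) gp_not_distinct[OF assms(2)]
    by (simp add: fund_circuit_outside zer_mult_right of_sign_closed)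
next
  case True
  then obtain i where i: "i < length ys" "e = ys ! i"
    by (metis in_set_conv_nth)
  let ?zs = "omit i ys"
  define x' where "x' = enum (E - set ?zs)"
  have ys: "ys = take i ys @ e # drop (Suc i) ys"
    using i by (simp add: id_take_nth_drop)
  have card: "card E = length ys + length xs"
    using assms(3,4) distinct_card by fastforce
  have zs: "set ?zs = set ys - {e}" "distinct ?zs"
    using set_omit[of ys i] assms(3) i by auto
  have ex: "distinct (e # xs)" "set (e # xs) = E - set ?zs" "e # xs \<in> tuples E r"
    using assms True zs by (auto simp: tuples_def)
  have "distinct x'" "set x' = E - set ?zs"
    using distinct_enum[of "E - set ?zs"] assms(1) by (auto simp: x'_def)
  with ex have "mset x' = mset (e # xs)"
    by (metis set_eq_iff_mset_eq_distinct)
  then obtain \<tau> where "\<tau> permutes {..<length (e # xs)}" "permute_list \<tau> (e # xs) = x'"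
    by (rule mset_eq_permutation)
  then have \<tau>: "\<tau> permutes {..<r}" "permute_list \<tau> (e # xs) = x'"
    using assms(5) by auto
  define s where "s = sorting_sign E (ys @ xs)"
  have signs: "s \<in> {1, -1}" "sign \<tau> \<in> {1, -1}" "(-1::int) ^ k \<in> {1, -1}" for k
    using sorting_sign_cases sign_cases[of \<tau>] by (auto simp: s_def minus_one_power_iff)
  have "sorting_sign E (?zs @ x') = sign \<tau> * sorting_sign E (?zs @ e # xs)"
    unfolding \<tau>(2)[symmetric]
  proof (rule sorting_sign_permute_suffix)
    show "distinct (?zs @ e # xs)" "set (?zs @ e # xs) = E"
      using ex zs assms(4) True by auto
  qed (use \<tau> assms(5) in auto)
  also have "sorting_sign E (?zs @ e # xs) = (-1) ^ (card E - r - i) * s"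
  proof -
    have "sorting_sign E (take i ys @ drop (Suc i) ys @ e # xs) =
        (-1) ^ length (drop (Suc i) ys) * sorting_sign E (take i ys @ e # drop (Suc i) ys @ xs)"
      using ys assms(3,4) by (intro sorting_sign_move) (metis append.assoc append_Cons)+
    moreover have "take i ys @ e # drop (Suc i) ys @ xs = ys @ xs"
      using ys by (metis append.assoc append_Cons)
    moreover have "length (drop (Suc i) ys) = card E - r - i"
      using card assms(5) by simp
    ultimately show ?thesis
      by (simp add: omit_def s_def)
  qed
  finally have sort: "sorting_sign E (?zs @ x') = sign \<tau> * ((-1) ^ (card E - r - i) * s)" .
  have zs_tuple: "?zs \<in> tuples E (card E - r)"
    using card assms(4,5) i zs by (auto simp: tuples_def omit_def)
  have carr: "\<phi> (e # xs) \<in> carrier F"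
    using ex(3) gp_closed[OF assms(2)] by blast
  have "fund_circuit F E (dual_gp F E r \<phi>) ys e = neg_one F [^] i \<otimes> dual_gp F E r \<phi> ?zs"
    using fund_circuit_nth[of ys E i] assms(3,4) i by auto
  also have "dual_gp F E r \<phi> ?zs = of_sign F (sign \<tau> * ((-1) ^ (card E - r - i) * s)) \<otimes> \<phi> x'"
    using zs_tuple zs(2) by (simp add: dual_gp_def x'_def[symmetric] sort Let_def)
  also have "\<phi> x' = of_sign F (sign \<tau>) \<otimes> \<phi> (e # xs)"
    using gp_permute[OF assms(2) ex(3) \<tau>(1)] \<tau>(2) by simp
  also have "neg_one F [^] i \<otimes> (of_sign F (sign \<tau> * ((-1) ^ (card E - r - i) * s)) \<otimes>
        (of_sign F (sign \<tau>) \<otimes> \<phi> (e # xs))) =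
      of_sign F ((-1) ^ i * (sign \<tau> * ((-1) ^ (card E - r - i) * s)) * sign \<tau>) \<otimes> \<phi> (e # xs)"
  proof -
    have "sign \<tau> * ((-1) ^ (card E - r - i) * s) \<in> {1, -1}"
      using signs by fastforce
    moreover from this have "(-1) ^ i * (sign \<tau> * ((-1) ^ (card E - r - i) * s)) \<in> {1, -1}"
      using signs(3)[of i] by fastforce
    ultimately show ?thesis
      using signs carr by (simp add: neg_one_pow of_sign_mult of_sign_closed m_assoc)
  qed
  also have "(-1) ^ i * (sign \<tau> * ((-1) ^ (card E - r - i) * s)) * sign \<tau> = (-1) ^ (card E - r) * s"
  proof -
    have "i \<le> card E - r"
      using i card assms(5) by linarith
    then have "(-1::int) ^ i * (-1) ^ (card E - r - i) = (-1) ^ (card E - r)"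
      by (metis le_add_diff_inverse power_add)
    moreover have "(-1) ^ i * (sign \<tau> * ((-1) ^ (card E - r - i) * s)) * sign \<tau> =
        ((-1) ^ i * (-1) ^ (card E - r - i)) * s * (sign \<tau> * sign \<tau>)"
      by (simp only: ac_simps)
    ultimately show ?thesis
      by simp
  qed
  finally show ?thesis
    by (simp add: s_def)
qed

text \<open>Vectors are tested on cocircuits, which by the preceding lemma are the functions
  \<open>e \<mapsto> \<phi> (e # xs)\<close>, up to units. A list \<open>xs\<close> with repeated entries gives the zero function, which
  imposes no condition.\<close>

lemma vectors_iff:
  assumes "finite (ground M)" "grassmann_pluecker F (ground M) (mrank M) \<phi>"
    and "gpclass M = gp_class F (ground M) (mrank M) \<phi>"
  shows "X \<in> vectors F M \<longleftrightarrow> X \<in> ground M \<rightarrow>\<^sub>E carrier F \<and>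
    (\<forall>xs. set xs \<subseteq> ground M \<longrightarrow> Suc (length xs) = mrank M \<longrightarrow>
      orthogonal F (ground M) X (\<lambda>e. \<phi> (e # xs)))"
proof (cases "X \<in> ground M \<rightarrow>\<^sub>E carrier F")
  case True
  let ?E = "ground M" and ?r = "mrank M"
  let ?D = "dual_gp F ?E ?r \<phi>"
  have X: "X \<in> ?E \<rightarrow> carrier F"
    using True by auto
  note orth = orthogonal_scale[OF of_sign_nonzero assms(1) X]
  have W: "(\<lambda>e. \<phi> (e # xs)) \<in> ?E \<rightarrow> carrier F" if "set xs \<subseteq> ?E" "Suc (length xs) = ?r" for xs
    using that gp_closed[OF assms(2)] by (auto simp: tuples_def Pi_iff)
  have "X \<in> vectors F M \<longleftrightarrow> (\<forall>Y \<in> circuits F (dual F M). orthogonal F (ground (dual F M)) X Y)"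
    using True by (simp add: vectors_def cocircuits_def dual_def)
  also have "\<dots> \<longleftrightarrow> (\<forall>ys \<in> tuples ?E (Suc (card ?E - ?r)). distinct ys \<longrightarrow>
      orthogonal F ?E X (fund_circuit F ?E ?D ys))"
  proof -
    have dual: "ground (dual F M) = ?E" "mrank (dual F M) = card ?E - ?r"
      by (simp_all add: dual_def)
    show ?thesis
      using orthogonal_circuits_iff[of "dual F M" ?D X] gpclass_dual[OF assms]
        dual_gp_closed[OF assms(1,2)] assms(1) X by (simp add: dual)
  qed
  also have "\<dots> \<longleftrightarrow> (\<forall>xs. set xs \<subseteq> ?E \<longrightarrow> Suc (length xs) = ?r \<longrightarrow>
      orthogonal F ?E X (\<lambda>e. \<phi> (e # xs)))"
  proof (intro iffI allI ballI impI)
    fix xs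
    assume l: "\<forall>ys \<in> tuples ?E (Suc (card ?E - ?r)). distinct ys \<longrightarrow>
        orthogonal F ?E X (fund_circuit F ?E ?D ys)"
      and xs: "set xs \<subseteq> ?E" "Suc (length xs) = ?r"
    show "orthogonal F ?E X (\<lambda>e. \<phi> (e # xs))"
    proof (cases "distinct xs")
      case True
      define ys where "ys = enum (?E - set xs)"
      have ys: "distinct ys" "set ys = ?E - set xs"
        using distinct_enum[of "?E - set xs"] assms(1) by (auto simp: ys_def)
      have "length ys = card ?E - card (set xs)"
        using distinct_card[OF ys(1)] ys(2) xs(1) by (simp add: card_Diff_subset)
      then have "length ys = Suc (card ?E - ?r)"
        using xs gp_rank_le[OF assms(2,1)] distinct_card[OF True] by simp
      with ys have "orthogonal F ?E X (fund_circuit F ?E ?D ys)"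
        using l by (auto simp: tuples_def)
      then show ?thesis
        using orth[OF W[OF xs] fund_circuit_dual_gp[OF assms(1,2), of ys xs]] ys xs True by auto
    next
      case False
      then have "\<phi> (e # xs) = zer F" if "e \<in> ?E" for e
        using that xs gp_not_distinct[OF assms(2), of "e # xs"] by (auto simp: tuples_def)
      then show ?thesis
        by (rule orthogonal_zer[OF assms(1) X])
    qed
  next
    fix ys
    assume r: "\<forall>xs. set xs \<subseteq> ?E \<longrightarrow> Suc (length xs) = ?r \<longrightarrow> orthogonal F ?E X (\<lambda>e. \<phi> (e # xs))"
      and ys: "ys \<in> tuples ?E (Suc (card ?E - ?r))" "distinct ys"
    define xs where "xs = enum (?E - set ys)"
    have xs: "distinct xs" "set xs = ?E - set ys"
      using distinct_enum[of "?E - set ys"] assms(1) by (auto simp: xs_def)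
    have len: "length ys = Suc (card ?E - ?r)" and sub: "set ys \<subseteq> ?E"
      using ys by (auto simp: tuples_def)
    have "length ys \<le> card ?E"
      using distinct_card[OF ys(2)] card_mono[OF assms(1) sub] by simp
    moreover have "length xs = card ?E - length ys"
      using distinct_card[OF xs(1)] xs(2) distinct_card[OF ys(2)] sub by (simp add: card_Diff_subset)
    ultimately have len_xs: "Suc (length xs) = ?r"
      using len gp_rank_le[OF assms(2,1)] by linarith
    have xs_sub: "set xs \<subseteq> ?E"
      using xs by blast
    have "distinct (ys @ xs)" "set (ys @ xs) = ?E"
      using xs ys sub by auto
    from orth[OF W[OF xs_sub len_xs] fund_circuit_dual_gp[OF assms(1,2) this len_xs]]
    show "orthogonal F ?E X (fund_circuit F ?E ?D ys)"
      using r xs_sub len_xs by simp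
  qed
  finally show ?thesis
    using True by blast
qed (simp add: vectors_def)

text \<open>By \<open>vectors_iff\<close> and \<open>orthogonal_fund_circuit_iff\<close>, the conditions to be checked are the Pluecker
  relations.\<close>

lemma fund_circuit_in_vectors:
  assumes "finite (ground M)" "grassmann_pluecker F (ground M) (mrank M) \<phi>"
    and "gpclass M = gp_class F (ground M) (mrank M) \<phi>"
    and "ys \<in> tuples (ground M) (Suc (mrank M))" "distinct ys"
  shows "fund_circuit F (ground M) \<phi> ys \<in> vectors F M"
proof -
  let ?E = "ground M" and ?r = "mrank M"
  note closed = fund_circuit_closed[OF gp_closed[OF assms(2)] assms(4,5)]
  have "orthogonal F ?E (fund_circuit F ?E \<phi> ys) (\<lambda>e. \<phi> (e # xs))"
    if xs: "set xs \<subseteq> ?E" "Suc (length xs) = ?r" for xs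
  proof -
    have W: "(\<lambda>e. \<phi> (e # xs)) \<in> ?E \<rightarrow> carrier F"
      using xs gp_closed[OF assms(2)] by (auto simp: tuples_def Pi_iff)
    have "orthogonal F ?E (\<lambda>e. \<phi> (e # xs)) (fund_circuit F ?E \<phi> ys)"
      using gp_null[OF assms(2) xs assms(4)]
        orthogonal_fund_circuit_iff[OF assms(1) gp_closed[OF assms(2)] W assms(4,5)] by simp
    then show ?thesis
      using orthogonal_commute[OF assms(1) W] closed by (auto simp: PiE_iff)
  qed
  with closed show ?thesis
    using vectors_iff[OF assms(1-3)] by blast
qed

end

section \<open>Perfection on arbitrary ground sets\<close>

lemma is_matroidE:
  assumes "is_matroid F M"
  obtains \<phi> where "finite (ground M)" "grassmann_pluecker F (ground M) (mrank M) \<phi>"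
    "gpclass M = gp_class F (ground M) (mrank M) \<phi>"
  using assms by (auto simp: is_matroid_def)

lemma permute_list_tuples:
  "xs \<in> tuples E r \<Longrightarrow> \<sigma> permutes {..<r} \<Longrightarrow> permute_list \<sigma> xs \<in> tuples E r"
  by (auto simp: tuples_def)

lemma map_omit: "map g (omit k ys) = omit k (map g ys)"
  by (simp add: omit_def take_map drop_map)

lemma map_tuples: "g ` D \<subseteq> E \<Longrightarrow> xs \<in> tuples D r \<Longrightarrow> map g xs \<in> tuples E r"
  by (auto simp: tuples_def)

context idyll
begin

lemma orthogonal_bij:
  assumes "bij_betw g D E" "finite E"
    and "\<And>d. d \<in> D \<Longrightarrow> X' d = X (g d)" "\<And>d. d \<in> D \<Longrightarrow> Y' d = Y (g d)"
  shows "orthogonal F D X' Y' \<longleftrightarrow> orthogonal F E X Y"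
proof -
  have "is_null F {#X e \<otimes> Y e. e \<in># mset_set E#} \<longleftrightarrow>
      is_null F {#X (g d) \<otimes> Y (g d). d \<in># mset_set D#}"
    using assms(1,2) by (intro is_null_reindex) (auto simp: bij_betw_def)
  also have "{#X (g d) \<otimes> Y (g d). d \<in># mset_set D#} = {#X' d \<otimes> Y' d. d \<in># mset_set D#}"
  proof (intro image_mset_cong)
    fix d
    assume "d \<in># mset_set D"
    then have "d \<in> D"
      using elem_mset_set[of D] mset_set.infinite[of D] by fastforce
    then show "X (g d) \<otimes> Y (g d) = X' d \<otimes> Y' d"
      using assms by simp
  qed
  finally show ?thesis
    by (simp add: orthogonal_def)
qed

lemma gp_pullback:
  assumes "bij_betw g D E" "grassmann_pluecker F E r \<phi>"
  shows "grassmann_pluecker F D r (\<lambda>xs\<in>tuples D r. \<phi> (map g xs))" (is "grassmann_pluecker F D r ?\<phi>")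
  unfolding grassmann_pluecker_def
proof (intro conjI)
  have inj: "inj_on g D" and img: "g ` D = E"
    using assms(1) by (auto simp: bij_betw_def)
  have tup: "map g xs \<in> tuples E r" if "xs \<in> tuples D r" for xs r
    using map_tuples[OF _ that] img by blast
  show "?\<phi> \<in> tuples D r \<rightarrow>\<^sub>E carrier F"
    using gp_closed[OF assms(2)] tup by auto
  obtain ys where ys: "ys \<in> tuples E r" "\<phi> ys \<noteq> zer F"
    using assms(2) by (auto simp: grassmann_pluecker_def)
  let ?xs = "map (inv_into D g) ys"
  have "?xs \<in> tuples D r"
    using ys(1) inv_into_into[of _ g D] img by (auto simp: tuples_def)
  moreover have "map g ?xs = ys"
    using ys(1) f_inv_into_f[of _ g D] img by (auto simp: tuples_def intro!: map_idI)
  ultimately show "\<exists>xs\<in>tuples D r. ?\<phi> xs \<noteq> zer F"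
    using ys(2) by (intro bexI[of _ ?xs]) (simp_all del: map_map)
  show "\<forall>xs\<in>tuples D r. \<forall>\<sigma>. \<sigma> permutes {..<r} \<longrightarrow>
      ?\<phi> (permute_list \<sigma> xs) = of_sign F (sign \<sigma>) \<otimes> ?\<phi> xs"
  proof (intro ballI allI impI)
    fix xs \<sigma>
    assume xs: "xs \<in> tuples D r" and \<sigma>: "\<sigma> permutes {..<r}"
    then have "map g (permute_list \<sigma> xs) = permute_list \<sigma> (map g xs)"
      by (simp add: tuples_def permute_list_map)
    then show "?\<phi> (permute_list \<sigma> xs) = of_sign F (sign \<sigma>) \<otimes> ?\<phi> xs"
      using gp_permute[OF assms(2) tup[OF xs] \<sigma>] permute_list_tuples[OF xs \<sigma>] xs by simp
  qed
  show "\<forall>xs\<in>tuples D r. \<not> distinct xs \<longrightarrow> ?\<phi> xs = zer F"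
    using gp_not_distinct[OF assms(2) tup] by (simp add: distinct_map)
  show "\<forall>xs ys. set xs \<subseteq> D \<and> Suc (length xs) = r \<and> ys \<in> tuples D (Suc r) \<longrightarrow>
      is_null F {#neg_one F [^] k \<otimes> ?\<phi> (omit k ys) \<otimes> ?\<phi> (ys ! k # xs). k \<in># mset_set {0..r}#}"
  proof (intro allI impI, elim conjE)
    fix xs ys
    assume xs: "set xs \<subseteq> D" "Suc (length xs) = r" and ys: "ys \<in> tuples D (Suc r)"
    have "{#neg_one F [^] k \<otimes> ?\<phi> (omit k ys) \<otimes> ?\<phi> (ys ! k # xs). k \<in># mset_set {0..r}#} =
        {#neg_one F [^] k \<otimes> \<phi> (omit k (map g ys)) \<otimes> \<phi> (map g ys ! k # map g xs).
          k \<in># mset_set {0..r}#}"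
    proof (intro image_mset_cong)
      fix k
      assume "k \<in># mset_set {0..r}"
      then have k: "k \<le> r" by simp
      then have "k < length ys" "ys ! k # xs \<in> tuples D r"
        using xs ys nth_mem[of k ys] by (auto simp: tuples_def)
      then show "neg_one F [^] k \<otimes> ?\<phi> (omit k ys) \<otimes> ?\<phi> (ys ! k # xs) =
          neg_one F [^] k \<otimes> \<phi> (omit k (map g ys)) \<otimes> \<phi> (map g ys ! k # map g xs)"
        using omit_tuples[OF ys k] by (simp add: map_omit)
    qed
    moreover have "set (map g xs) \<subseteq> E" "Suc (length (map g xs)) = r"
      using xs img by auto
    ultimately show "is_null F {#neg_one F [^] k \<otimes> ?\<phi> (omit k ys) \<otimes> ?\<phi> (ys ! k # xs).
        k \<in># mset_set {0..r}#}"
      using gp_null[OF assms(2) _ _ tup[OF ys], of "map g xs"] by simp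
  qed
qed

text \<open>Perfection is a statement about matroids on sets of natural numbers. To apply it, the matroid, the
  vector and the covector are pulled back along an enumeration of the ground set; the descriptions
  of vectors and covectors by a single representative carry over term by term.\<close>

lemma perfect_orthogonal:
  fixes M :: "('e, 'a) pre_matroid"
  assumes "perfect_idyll F" "is_matroid F M" "X \<in> vectors F M" "Y \<in> covectors F M"
  shows "orthogonal F (ground M) X Y"
proof -
  let ?E = "ground M" and ?r = "mrank M"
  obtain \<phi> where M: "finite ?E" "grassmann_pluecker F ?E ?r \<phi>" "gpclass M = gp_class F ?E ?r \<phi>"
    using is_matroidE[OF assms(2)] .
  define D where "D = {0..<card ?E}"
  obtain g where g: "bij_betw g D ?E"
    using ex_bij_betw_nat_finite[OF M(1)] by (auto simp: D_def)
  have img: "g ` D \<subseteq> ?E" and fin: "finite D"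
    using g by (auto simp: bij_betw_def D_def)
  define \<psi> where "\<psi> = (\<lambda>xs\<in>tuples D ?r. \<phi> (map g xs))"
  define L :: "(nat, 'a) pre_matroid" where "L = \<lparr>ground = D, mrank = ?r, gpclass = gp_class F D ?r \<psi>\<rparr>"
  have L: "ground L = D" "mrank L = ?r" "gpclass L = gp_class F (ground L) (mrank L) \<psi>"
    by (simp_all add: L_def)
  have gp: "grassmann_pluecker F (ground L) (mrank L) \<psi>"
    using gp_pullback[OF g M(2)] by (simp add: L \<psi>_def)
  have finL: "finite (ground L)"
    by (simp add: L fin)
  define X' where "X' = (\<lambda>d\<in>D. X (g d))"
  define Y' where "Y' = (\<lambda>d\<in>D. Y (g d))"
  have "orthogonal F D X' (\<lambda>e. \<psi> (e # xs))" if xs: "set xs \<subseteq> D" "Suc (length xs) = ?r" for xs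
  proof -
    have "set (map g xs) \<subseteq> ?E" "Suc (length (map g xs)) = ?r"
      using xs img by auto
    then have "orthogonal F ?E X (\<lambda>e. \<phi> (e # map g xs))"
      using assms(3) vectors_iff[OF M] by blast
    moreover have "\<psi> (d # xs) = \<phi> (g d # map g xs)" if "d \<in> D" for d
      using that xs by (simp add: \<psi>_def tuples_def)
    ultimately show ?thesis
      using orthogonal_bij[OF g M(1), of X' X "\<lambda>e. \<psi> (e # xs)" "\<lambda>e. \<phi> (e # map g xs)"]
      by (simp add: X'_def)
  qed
  moreover have "X' \<in> D \<rightarrow>\<^sub>E carrier F"
    using assms(3) img by (auto simp: X'_def vectors_def)
  ultimately have X': "X' \<in> vectors F L"
    using vectors_iff[OF finL gp L(3), of X'] by (simp add: L)
  have "is_null F {#neg_one F [^] k \<otimes> \<psi> (omit k ys) \<otimes> Y' (ys ! k). k \<in># mset_set {0..?r}#}"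
    if ys: "ys \<in> tuples D (Suc ?r)" "distinct ys" for ys
  proof -
    have "map g ys \<in> tuples ?E (Suc ?r)" "distinct (map g ys)"
      using ys map_tuples[OF img ys(1)] g
      by (auto simp: bij_betw_def distinct_map tuples_def intro: inj_on_subset)
    then have "is_null F {#neg_one F [^] k \<otimes> \<phi> (omit k (map g ys)) \<otimes> Y (map g ys ! k).
        k \<in># mset_set {0..?r}#}"
      using assms(4) covectors_iff[OF M] by blast
    also have "{#neg_one F [^] k \<otimes> \<phi> (omit k (map g ys)) \<otimes> Y (map g ys ! k). k \<in># mset_set {0..?r}#} =
        {#neg_one F [^] k \<otimes> \<psi> (omit k ys) \<otimes> Y' (ys ! k). k \<in># mset_set {0..?r}#}"
    proof (intro image_mset_cong)
      fix k
      assume "k \<in># mset_set {0..?r}"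
      then have k: "k \<le> ?r" by simp
      then have "k < length ys" "ys ! k \<in> D"
        using ys nth_mem[of k ys] by (auto simp: tuples_def)
      then show "neg_one F [^] k \<otimes> \<phi> (omit k (map g ys)) \<otimes> Y (map g ys ! k) =
          neg_one F [^] k \<otimes> \<psi> (omit k ys) \<otimes> Y' (ys ! k)"
        using omit_tuples[OF ys(1) k] by (simp add: map_omit \<psi>_def Y'_def)
    qed
    finally show ?thesis .
  qed
  moreover have "Y' \<in> D \<rightarrow>\<^sub>E carrier F"
    using assms(4) img by (auto simp: Y'_def covectors_def)
  ultimately have Y': "Y' \<in> covectors F L"
    using covectors_iff[OF finL gp L(3), of Y'] by (simp add: L)
  have "is_matroid F L"
    using finL gp L(3) unfolding is_matroid_def by blast
  then have "orthogonal F (ground L) X' Y'"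
    using assms(1) X' Y' unfolding perfect_idyll_def by blast
  then show ?thesis
    using orthogonal_bij[OF g M(1), of X' X Y' Y] by (simp add: L X'_def Y'_def)
qed

end


section \<open>Submonomial matrices\<close>

definition transpose_matrix :: "'t set \<Rightarrow> 's set \<Rightarrow> ('t \<times> 's \<Rightarrow> 'a) \<Rightarrow> 's \<times> 't \<Rightarrow> 'a"
  where "transpose_matrix T S \<Phi> = (\<lambda>(j, i) \<in> S \<times> T. \<Phi> (i, j))"

lemma sum_single_zer: "(\<And>j. j \<in> S \<Longrightarrow> g j = zer F) \<Longrightarrow> sum_single F S g = zer F"
  by (auto simp: sum_single_def)

lemma sum_single_eq:
  assumes "j \<in> S" "\<And>k. k \<in> S \<Longrightarrow> k \<noteq> j \<Longrightarrow> g k = zer F"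
  shows "sum_single F S g = g j"
proof (cases "g j = zer F")
  case True
  with assms have "\<And>k. k \<in> S \<Longrightarrow> g k = zer F"
    by metis
  then show ?thesis
    using True by (simp add: sum_single_zer)
next
  case False
  then have "(THE k. k \<in> S \<and> g k \<noteq> zer F) = j"
    using assms by (intro the_equality) auto
  with False assms(1) show ?thesis
    by (auto simp: sum_single_def)
qed

lemma submonomial_closed: "submonomial F T S \<Phi> \<Longrightarrow> i \<in> T \<Longrightarrow> j \<in> S \<Longrightarrow> \<Phi> (i, j) \<in> carrier F"
  by (auto simp: submonomial_def PiE_iff)

lemma submonomial_row:
  "submonomial F T S \<Phi> \<Longrightarrow> i \<in> T \<Longrightarrow> j \<in> S \<Longrightarrow> k \<in> S \<Longrightarrow> \<Phi> (i, j) \<noteq> zer F \<Longrightarrow> k \<noteq> j \<Longrightarrow> \<Phi> (i, k) = zer F"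
  unfolding submonomial_def Uniq_def by blast

lemma submonomial_col:
  "submonomial F T S \<Phi> \<Longrightarrow> j \<in> S \<Longrightarrow> i \<in> T \<Longrightarrow> k \<in> T \<Longrightarrow> \<Phi> (i, j) \<noteq> zer F \<Longrightarrow> k \<noteq> i \<Longrightarrow> \<Phi> (k, j) = zer F"
  unfolding submonomial_def Uniq_def by blast

lemma submonomialI:
  assumes "\<Phi> \<in> T \<times> S \<rightarrow>\<^sub>E carrier F"
    and "\<And>i j k. i \<in> T \<Longrightarrow> j \<in> S \<Longrightarrow> k \<in> S \<Longrightarrow> \<Phi> (i, j) \<noteq> zer F \<Longrightarrow> \<Phi> (i, k) \<noteq> zer F \<Longrightarrow> j = k"
    and "\<And>i j k. j \<in> S \<Longrightarrow> i \<in> T \<Longrightarrow> k \<in> T \<Longrightarrow> \<Phi> (i, j) \<noteq> zer F \<Longrightarrow> \<Phi> (k, j) \<noteq> zer F \<Longrightarrow> i = k"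
  shows "submonomial F T S \<Phi>"
  unfolding submonomial_def Uniq_def using assms by blast

lemma submonomial_transpose:
  assumes "submonomial F T S \<Phi>"
  shows "submonomial F S T (transpose_matrix T S \<Phi>)"
proof (rule submonomialI)
  show "transpose_matrix T S \<Phi> \<in> S \<times> T \<rightarrow>\<^sub>E carrier F"
    using submonomial_closed[OF assms] by (auto simp: transpose_matrix_def)
  show "i = k" if "j \<in> S" "i \<in> T" "k \<in> T"
    "transpose_matrix T S \<Phi> (j, i) \<noteq> zer F" "transpose_matrix T S \<Phi> (j, k) \<noteq> zer F" for i j k
    using that submonomial_col[OF assms, of j i k] by (auto simp: transpose_matrix_def)
  show "i = k" if "j \<in> T" "i \<in> S" "k \<in> S"
    "transpose_matrix T S \<Phi> (i, j) \<noteq> zer F" "transpose_matrix T S \<Phi> (k, j) \<noteq> zer F" for i j k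
    using that submonomial_row[OF assms, of j i k] by (auto simp: transpose_matrix_def)
qed

context idyll
begin

lemma mat_vec_row:
  assumes "submonomial F T S \<Phi>" "X \<in> S \<rightarrow> carrier F" "i \<in> T" "j \<in> S" "\<Phi> (i, j) \<noteq> zer F"
  shows "mat_vec F T S \<Phi> X i = \<Phi> (i, j) \<otimes> X j"
proof -
  have "\<Phi> (i, k) \<otimes> X k = zer F" if "k \<in> S" "k \<noteq> j" for k
    using that submonomial_row[OF assms(1,3,4) that(1) assms(5)] assms(2)
    by (simp add: zer_mult Pi_iff)
  then have "sum_single F S (\<lambda>j. \<Phi> (i, j) \<otimes> X j) = \<Phi> (i, j) \<otimes> X j"
    by (rule sum_single_eq[OF assms(4)])
  with assms(3) show ?thesis
    by (simp add: mat_vec_def)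
qed

lemma mat_vec_zer_row:
  assumes "X \<in> S \<rightarrow> carrier F" "i \<in> T" "\<And>j. j \<in> S \<Longrightarrow> \<Phi> (i, j) = zer F"
  shows "mat_vec F T S \<Phi> X i = zer F"
proof -
  have "sum_single F S (\<lambda>j. \<Phi> (i, j) \<otimes> X j) = zer F"
    using assms by (intro sum_single_zer) (simp add: zer_mult Pi_iff)
  with assms(2) show ?thesis
    by (simp add: mat_vec_def)
qed

lemma mat_vec_closed:
  assumes "submonomial F T S \<Phi>" "X \<in> S \<rightarrow> carrier F"
  shows "mat_vec F T S \<Phi> X \<in> T \<rightarrow>\<^sub>E carrier F"
proof (rule PiE_I)
  fix i
  assume i: "i \<in> T"
  show "mat_vec F T S \<Phi> X i \<in> carrier F"
  proof (cases "\<exists>j \<in> S. \<Phi> (i, j) \<noteq> zer F")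
    case True
    then obtain j where j: "j \<in> S" "\<Phi> (i, j) \<noteq> zer F"
      by blast
    then show ?thesis
      using mat_vec_row[OF assms i j] submonomial_closed[OF assms(1) i j(1)] assms(2) by auto
  next
    case False
    then show ?thesis
      using mat_vec_zer_row[OF assms(2) i] zer_closed by fastforce
  qed
qed (simp add: mat_vec_def)

text \<open>A row of \<open>\<Phi>\<close> has at most one nonzero entry, so the nonzero terms of the sum over the rows
  correspond to positions of nonzero entries. The resulting sum is symmetric in rows and columns.\<close>

lemma orthogonal_mat_vec_iff:
  assumes "finite S" "finite T" "submonomial F T S \<Phi>" "X \<in> S \<rightarrow> carrier F" "Y \<in> T \<rightarrow> carrier F"
  shows "orthogonal F T (mat_vec F T S \<Phi> X) Y \<longleftrightarrow>
    is_null F {#\<Phi> p \<otimes> X (snd p) \<otimes> Y (fst p). p \<in># mset_set {p \<in> T \<times> S. \<Phi> p \<noteq> zer F}#}"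
proof -
  let ?J = "{p \<in> T \<times> S. \<Phi> p \<noteq> zer F}"
  let ?X = "mat_vec F T S \<Phi> X"
  have "is_null F {#?X i \<otimes> Y i. i \<in># mset_set T#} \<longleftrightarrow>
      is_null F {#?X (fst p) \<otimes> Y (fst p). p \<in># mset_set ?J#}"
  proof (rule is_null_reindex)
    show "inj_on fst ?J"
    proof (rule inj_onI)
      fix p q
      assume pq: "p \<in> ?J" "q \<in> ?J" "fst p = fst q"
      then have "snd q = snd p"
        using submonomial_row[OF assms(3), of "fst p" "snd p" "snd q"]
        by (cases "snd q = snd p") auto
      with pq(3) show "p = q"
        by (simp add: prod_eq_iff)
    qed
    show "i \<in> fst ` ?J" if i: "i \<in> T" "?X i \<otimes> Y i \<noteq> zer F" for i
    proof -
      have "?X i \<noteq> zer F"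
        using i zer_mult[of "Y i"] assms(5) by (auto simp: Pi_iff)
      then obtain j where "j \<in> S" "\<Phi> (i, j) \<noteq> zer F"
        using mat_vec_zer_row[OF assms(4) i(1), of \<Phi>] by blast
      with i(1) show ?thesis
        by force
    qed
  qed (use assms in auto)
  also have "{#?X (fst p) \<otimes> Y (fst p). p \<in># mset_set ?J#} =
      {#\<Phi> p \<otimes> X (snd p) \<otimes> Y (fst p). p \<in># mset_set ?J#}"
    using mat_vec_row[OF assms(3,4)] assms(1,2) by (intro image_mset_cong) auto
  finally show ?thesis
    by (simp add: orthogonal_def)
qed

lemma orthogonal_adjoint:
  assumes "finite S" "finite T" "submonomial F T S \<Phi>" "X \<in> S \<rightarrow> carrier F" "Y \<in> T \<rightarrow> carrier F"
  shows "orthogonal F T (mat_vec F T S \<Phi> X) Y \<longleftrightarrow>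
    orthogonal F S X (mat_vec F S T (transpose_matrix T S \<Phi>) Y)"
proof -
  let ?\<Psi> = "transpose_matrix T S \<Phi>"
  let ?J = "{p \<in> T \<times> S. \<Phi> p \<noteq> zer F}" and ?K = "{q \<in> S \<times> T. ?\<Psi> q \<noteq> zer F}"
  have K: "prod.swap ` ?K = ?J"
    by (auto simp: transpose_matrix_def image_iff)
  have "is_null F {#\<Phi> p \<otimes> X (snd p) \<otimes> Y (fst p). p \<in># mset_set ?J#} \<longleftrightarrow>
      is_null F {#\<Phi> (prod.swap q) \<otimes> X (snd (prod.swap q)) \<otimes> Y (fst (prod.swap q)). q \<in># mset_set ?K#}"
    using assms(1,2) K by (intro is_null_reindex) (auto simp: inj_on_def)
  also have "{#\<Phi> (prod.swap q) \<otimes> X (snd (prod.swap q)) \<otimes> Y (fst (prod.swap q)). q \<in># mset_set ?K#} =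
      {#?\<Psi> q \<otimes> Y (snd q) \<otimes> X (fst q). q \<in># mset_set ?K#}"
  proof (intro image_mset_cong)
    fix q
    assume "q \<in># mset_set ?K"
    then obtain j i where q: "q = (j, i)" "j \<in> S" "i \<in> T"
      using assms(1,2) by auto
    then have "X j \<in> carrier F" "Y i \<in> carrier F" "\<Phi> (i, j) \<in> carrier F"
      using assms(4,5) submonomial_closed[OF assms(3)] by auto
    then show "\<Phi> (prod.swap q) \<otimes> X (snd (prod.swap q)) \<otimes> Y (fst (prod.swap q)) =
        ?\<Psi> q \<otimes> Y (snd q) \<otimes> X (fst q)"
      using q by (simp add: transpose_matrix_def m_ac)
  qed
  finally have "orthogonal F T (mat_vec F T S \<Phi> X) Y \<longleftrightarrow>
      orthogonal F S (mat_vec F S T ?\<Psi> Y) X"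
    using orthogonal_mat_vec_iff[OF assms]
      orthogonal_mat_vec_iff[OF assms(2,1) submonomial_transpose[OF assms(3)] assms(5,4)] by simp
  then show ?thesis
    using orthogonal_commute[OF assms(1,4), of "mat_vec F S T ?\<Psi> Y"]
      mat_vec_closed[OF submonomial_transpose[OF assms(3)] assms(5)] by (auto simp: PiE_iff)
qed


text \<open>A product is computed column by column, which reduces associativity to \<open>mat_vec_mat_mult\<close> below.\<close>

lemma mat_mult_eq_mat_vec:
  assumes "i \<in> U" "k \<in> S"
  shows "mat_mult F U T S \<Psi> \<Phi> (i, k) = mat_vec F U T \<Psi> (\<lambda>j. \<Phi> (j, k)) i"
  using assms by (simp add: mat_mult_def mat_vec_def)

lemma mat_mult_row:
  assumes "submonomial F U T \<Psi>" "submonomial F T S \<Phi>" "i \<in> U" "k \<in> S" "j \<in> T" "\<Psi> (i, j) \<noteq> zer F"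
  shows "mat_mult F U T S \<Psi> \<Phi> (i, k) = \<Psi> (i, j) \<otimes> \<Phi> (j, k)"
  using mat_mult_eq_mat_vec[OF assms(3,4), where T = T] mat_vec_row[OF assms(1) _ assms(3,5,6), of "\<lambda>j. \<Phi> (j, k)"]
    submonomial_closed[OF assms(2) _ assms(4)] by simp

lemma mat_mult_zer_row:
  assumes "submonomial F U T \<Psi>" "submonomial F T S \<Phi>" "i \<in> U" "k \<in> S"
    and "\<And>j. j \<in> T \<Longrightarrow> \<Psi> (i, j) = zer F"
  shows "mat_mult F U T S \<Psi> \<Phi> (i, k) = zer F"
  using mat_mult_eq_mat_vec[OF assms(3,4), where T = T]
    mat_vec_zer_row[of "\<lambda>j. \<Phi> (j, k)" T i U \<Psi>, OF _ assms(3,5)]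
    submonomial_closed[OF assms(2) _ assms(4)] by simp

lemma mat_mult_nonzero:
  assumes "submonomial F U T \<Psi>" "submonomial F T S \<Phi>" "i \<in> U" "k \<in> S"
    and "mat_mult F U T S \<Psi> \<Phi> (i, k) \<noteq> zer F"
  obtains j where "j \<in> T" "\<Psi> (i, j) \<noteq> zer F" "\<Phi> (j, k) \<noteq> zer F"
proof -
  obtain j where j: "j \<in> T" "\<Psi> (i, j) \<noteq> zer F"
    using mat_mult_zer_row[OF assms(1-4)] assms(5) by blast
  moreover have "\<Phi> (j, k) \<noteq> zer F"
    using mat_mult_row[OF assms(1-4) j] assms(5) submonomial_closed[OF assms(1,3) j(1)]
    by (auto simp: zer_mult_right)
  ultimately show thesis
    by (rule that)
qed

lemma submonomial_mat_mult:
  assumes "submonomial F U T \<Psi>" "submonomial F T S \<Phi>"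
  shows "submonomial F U S (mat_mult F U T S \<Psi> \<Phi>)"
proof (rule submonomialI)
  let ?P = "mat_mult F U T S \<Psi> \<Phi>"
  have "?P (i, k) \<in> carrier F" if "i \<in> U" "k \<in> S" for i k
    using mat_mult_eq_mat_vec[OF that, where T = T] mat_vec_closed[OF assms(1), of "\<lambda>j. \<Phi> (j, k)"]
      submonomial_closed[OF assms(2) _ that(2)] that(1) by (auto simp: PiE_iff)
  then show "?P \<in> U \<times> S \<rightarrow>\<^sub>E carrier F"
    by (auto simp: mat_mult_def)
  show "k = l" if ik: "i \<in> U" "k \<in> S" "l \<in> S" and nz: "?P (i, k) \<noteq> zer F" "?P (i, l) \<noteq> zer F" for i k l
  proof -
    obtain j where j: "j \<in> T" "\<Psi> (i, j) \<noteq> zer F" "\<Phi> (j, k) \<noteq> zer F"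
      using mat_mult_nonzero[OF assms ik(1,2) nz(1)] .
    obtain j' where j': "j' \<in> T" "\<Psi> (i, j') \<noteq> zer F" "\<Phi> (j', l) \<noteq> zer F"
      using mat_mult_nonzero[OF assms ik(1,3) nz(2)] .
    have "j' = j"
      using submonomial_row[OF assms(1) ik(1) j(1) j'(1) j(2)] j'(2) by blast
    then show ?thesis
      using submonomial_row[OF assms(2) j(1) ik(2,3) j(3)] j'(3) by blast
  qed
  show "i = h" if ik: "k \<in> S" "i \<in> U" "h \<in> U" and nz: "?P (i, k) \<noteq> zer F" "?P (h, k) \<noteq> zer F" for i h k
  proof -
    obtain j where j: "j \<in> T" "\<Psi> (i, j) \<noteq> zer F" "\<Phi> (j, k) \<noteq> zer F"
      using mat_mult_nonzero[OF assms ik(2,1) nz(1)] .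
    obtain j' where j': "j' \<in> T" "\<Psi> (h, j') \<noteq> zer F" "\<Phi> (j', k) \<noteq> zer F"
      using mat_mult_nonzero[OF assms ik(3,1) nz(2)] .
    have "j' = j"
      using submonomial_col[OF assms(2) ik(1) j(1) j'(1) j(3)] j'(3) by blast
    then show ?thesis
      using submonomial_col[OF assms(1) j(1) ik(2,3) j(2)] j'(2) by blast
  qed
qed

text \<open>Row \<open>i\<close> of the product leads from \<open>i\<close> to the only possible \<open>j\<close> with \<open>\<Psi> (i, j) \<noteq> 0\<close>, and from there to
  the only possible \<open>k\<close> with \<open>\<Phi> (j, k) \<noteq> 0\<close>. If one of them does not exist, then both sides vanish at \<open>i\<close>.\<close>

lemma mat_vec_mat_mult:
  assumes "submonomial F U T \<Psi>" "submonomial F T S \<Phi>" "X \<in> S \<rightarrow> carrier F"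
  shows "mat_vec F U S (mat_mult F U T S \<Psi> \<Phi>) X = mat_vec F U T \<Psi> (mat_vec F T S \<Phi> X)"
proof
  fix i
  let ?P = "mat_mult F U T S \<Psi> \<Phi>" and ?X = "mat_vec F T S \<Phi> X"
  note P = submonomial_mat_mult[OF assms(1,2)]
  have X: "?X \<in> T \<rightarrow> carrier F"
    using mat_vec_closed[OF assms(2,3)] by (auto simp: PiE_iff)
  show "mat_vec F U S ?P X i = mat_vec F U T \<Psi> ?X i"
  proof (cases "i \<in> U")
    case i: True
    show ?thesis
    proof (cases "\<exists>j \<in> T. \<Psi> (i, j) \<noteq> zer F")
      case True
      then obtain j where j: "j \<in> T" "\<Psi> (i, j) \<noteq> zer F"
        by blast
      note entry = mat_mult_row[OF assms(1,2) i _ j]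
      have rhs: "mat_vec F U T \<Psi> ?X i = \<Psi> (i, j) \<otimes> ?X j"
        by (rule mat_vec_row[OF assms(1) X i j])
      have carr: "\<Psi> (i, j) \<in> carrier F"
        by (rule submonomial_closed[OF assms(1) i j(1)])
      show ?thesis
      proof (cases "\<exists>k \<in> S. \<Phi> (j, k) \<noteq> zer F")
        case True
        then obtain k where k: "k \<in> S" "\<Phi> (j, k) \<noteq> zer F"
          by blast
        have carr': "\<Phi> (j, k) \<in> carrier F" "X k \<in> carrier F"
          using submonomial_closed[OF assms(2) j(1) k(1)] assms(3) k(1) by auto
        have "?P (i, k) \<noteq> zer F"
          using entry[OF k(1)] mult_eq_zer_iff[OF carr carr'(1)] j k by simp
        then have "mat_vec F U S ?P X i = ?P (i, k) \<otimes> X k"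
          by (rule mat_vec_row[OF P assms(3) i k(1)])
        with rhs mat_vec_row[OF assms(2,3) j(1) k] entry[OF k(1)] carr carr' show ?thesis
          by (simp add: m_assoc)
      next
        case False
        then have "mat_vec F U S ?P X i = zer F"
          using entry carr by (intro mat_vec_zer_row assms(3) i) (simp add: zer_mult_right)
        moreover have "?X j = zer F"
          using False by (intro mat_vec_zer_row assms(3) j) simp
        ultimately show ?thesis
          using rhs carr by (simp add: zer_mult_right)
      qed
    next
      case False
      then have "?P (i, k) = zer F" if "k \<in> S" for k
        using that by (intro mat_mult_zer_row[OF assms(1,2) i]) auto
      then have "mat_vec F U S ?P X i = zer F"
        by (intro mat_vec_zer_row[OF assms(3) i])
      moreover have "mat_vec F U T \<Psi> ?X i = zer F"
        using False by (intro mat_vec_zer_row[OF X i]) simp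
      ultimately show ?thesis
        by simp
    qed
  qed (simp add: mat_vec_def)
qed

lemma submonomial_mat_id: "submonomial F S S (mat_id F S)"
  by (rule submonomialI) (auto simp: mat_id_def zer_closed split: if_splits)

lemma mat_vec_mat_id:
  assumes "X \<in> S \<rightarrow> carrier F" "i \<in> S"
  shows "mat_vec F S S (mat_id F S) X i = X i"
  using mat_vec_row[OF submonomial_mat_id assms(1,2,2)] assms
  by (auto simp: mat_id_def one_neq_zer Pi_iff)

lemma mat_mult_extensional: "mat_mult F U T S \<Psi> \<Phi> \<in> extensional (U \<times> S)"
  by (simp add: mat_mult_def)

lemma mat_mult_mat_id_left:
  assumes "submonomial F T S \<Phi>"
  shows "mat_mult F T T S (mat_id F T) \<Phi> = \<Phi>"
proof (rule extensionalityI[OF mat_mult_extensional])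
  show "\<Phi> \<in> extensional (T \<times> S)"
    using assms by (auto simp: submonomial_def PiE_def)
  show "mat_mult F T T S (mat_id F T) \<Phi> p = \<Phi> p" if "p \<in> T \<times> S" for p
    using that mat_mult_eq_mat_vec[of "fst p" T "snd p" S, where T = T]
      mat_vec_mat_id[of "\<lambda>j. \<Phi> (j, snd p)" T "fst p"] submonomial_closed[OF assms, of _ "snd p"]
    by auto
qed

lemma mat_mult_mat_id_right:
  assumes "submonomial F T S \<Phi>"
  shows "mat_mult F T S S \<Phi> (mat_id F S) = \<Phi>"
proof (rule extensionalityI[OF mat_mult_extensional])
  show "\<Phi> \<in> extensional (T \<times> S)"
    using assms by (auto simp: submonomial_def PiE_def)
  show "mat_mult F T S S \<Phi> (mat_id F S) p = \<Phi> p" if p: "p \<in> T \<times> S" for p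
  proof -
    obtain i k where ik: "p = (i, k)" "i \<in> T" "k \<in> S"
      using p by blast
    show ?thesis
    proof (cases "\<exists>j \<in> S. \<Phi> (i, j) \<noteq> zer F")
      case True
      then obtain j where j: "j \<in> S" "\<Phi> (i, j) \<noteq> zer F"
        by blast
      have "mat_mult F T S S \<Phi> (mat_id F S) p = \<Phi> (i, j) \<otimes> mat_id F S (j, k)"
        using mat_mult_row[OF assms submonomial_mat_id ik(2,3) j] ik(1) by simp
      then show ?thesis
        using submonomial_row[OF assms ik(2) j(1) ik(3) j(2)] submonomial_closed[OF assms ik(2) j(1)]
          ik j by (auto simp: mat_id_def zer_mult_right)
    next
      case False
      then show ?thesis
        using mat_mult_zer_row[OF assms submonomial_mat_id ik(2,3)] ik by auto
    qed
  qed
qed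

lemma mat_mult_assoc:
  assumes "submonomial F V U \<Xi>" "submonomial F U T \<Psi>" "submonomial F T S \<Phi>"
  shows "mat_mult F V T S (mat_mult F V U T \<Xi> \<Psi>) \<Phi> = mat_mult F V U S \<Xi> (mat_mult F U T S \<Psi> \<Phi>)"
proof (rule extensionalityI[OF mat_mult_extensional mat_mult_extensional])
  fix p
  assume "p \<in> V \<times> S"
  then obtain i k where ik: "p = (i, k)" "i \<in> V" "k \<in> S"
    by blast
  note PS = submonomial_mat_mult[OF assms(2,3)] and XP = submonomial_mat_mult[OF assms(1,2)]
  have X: "(\<lambda>j. \<Phi> (j, k)) \<in> T \<rightarrow> carrier F"
    using submonomial_closed[OF assms(3) _ ik(3)] by auto
  have "mat_mult F V T S (mat_mult F V U T \<Xi> \<Psi>) \<Phi> p =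
      mat_vec F V U \<Xi> (mat_vec F U T \<Psi> (\<lambda>j. \<Phi> (j, k))) i"
    using mat_mult_eq_mat_vec[OF ik(2,3), where T = T] mat_vec_mat_mult[OF assms(1,2) X] ik(1) by simp
  also have "\<dots> = mat_vec F V U \<Xi> (\<lambda>j. mat_mult F U T S \<Psi> \<Phi> (j, k)) i"
  proof (cases "\<exists>j \<in> U. \<Xi> (i, j) \<noteq> zer F")
    case True
    then obtain j where j: "j \<in> U" "\<Xi> (i, j) \<noteq> zer F"
      by blast
    have "mat_vec F U T \<Psi> (\<lambda>j. \<Phi> (j, k)) \<in> U \<rightarrow> carrier F"
      using mat_vec_closed[OF assms(2) X] by (auto simp: PiE_iff)
    moreover have "(\<lambda>j. mat_mult F U T S \<Psi> \<Phi> (j, k)) \<in> U \<rightarrow> carrier F"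
      using submonomial_closed[OF PS _ ik(3)] by auto
    ultimately show ?thesis
      using mat_vec_row[OF assms(1) _ ik(2) j] mat_mult_eq_mat_vec[OF j(1) ik(3), where T = T] by simp
  next
    case False
    have "mat_vec F U T \<Psi> (\<lambda>j. \<Phi> (j, k)) \<in> U \<rightarrow> carrier F"
      using mat_vec_closed[OF assms(2) X] by (auto simp: PiE_iff)
    moreover have "(\<lambda>j. mat_mult F U T S \<Psi> \<Phi> (j, k)) \<in> U \<rightarrow> carrier F"
      using submonomial_closed[OF PS _ ik(3)] by auto
    ultimately show ?thesis
      using mat_vec_zer_row[OF _ ik(2), of _ U \<Xi>] False by simp
  qed
  also have "\<dots> = mat_mult F V U S \<Xi> (mat_mult F U T S \<Psi> \<Phi>) p"
    using mat_mult_eq_mat_vec[OF ik(2,3), where T = U] ik(1) by simp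
  finally show "mat_mult F V T S (mat_mult F V U T \<Xi> \<Psi>) \<Phi> p =
      mat_mult F V U S \<Xi> (mat_mult F U T S \<Psi> \<Phi>) p" .
qed


section \<open>The category of matroids\<close>

lemma vectors_closed: "X \<in> vectors F M \<Longrightarrow> X \<in> ground M \<rightarrow>\<^sub>E carrier F"
  by (simp add: vectors_def)

lemma matroid_morphism_id:
  assumes "is_matroid F M"
  shows "matroid_morphism F M M (mat_id F (ground M))"
proof -
  let ?E = "ground M"
  have "mat_vec F ?E ?E (mat_id F ?E) X = X" if "X \<in> vectors F M" for X
  proof (rule extensionalityI)
    show "X \<in> extensional ?E"
      using vectors_closed[OF that] by (simp add: PiE_def)
    show "mat_vec F ?E ?E (mat_id F ?E) X e = X e" if "e \<in> ?E" for e
      using mat_vec_mat_id[OF _ that, of X] vectors_closed[OF \<open>X \<in> vectors F M\<close>] by (auto simp: PiE_def)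
  qed (simp add: mat_vec_def)
  then show ?thesis
    using assms submonomial_mat_id by (auto simp: matroid_morphism_def)
qed

lemma matroid_morphism_comp:
  assumes "matroid_morphism F L N \<Phi>" "matroid_morphism F N M \<Psi>"
  shows "matroid_morphism F L M (mat_mult F (ground M) (ground N) (ground L) \<Psi> \<Phi>)"
proof -
  have sub: "submonomial F (ground N) (ground L) \<Phi>" "submonomial F (ground M) (ground N) \<Psi>"
    using assms by (auto simp: matroid_morphism_def)
  have "mat_vec F (ground M) (ground L) (mat_mult F (ground M) (ground N) (ground L) \<Psi> \<Phi>) X
      \<in> vectors F M" if X: "X \<in> vectors F L" for X
  proof -
    have "X \<in> ground L \<rightarrow> carrier F"
      using vectors_closed[OF X] by (auto simp: PiE_def)
    then show ?thesis
      using assms X mat_vec_mat_mult[OF sub(2,1)] by (simp add: matroid_morphism_def image_subset_iff)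
  qed
  then show ?thesis
    using assms submonomial_mat_mult[OF sub(2,1)] by (auto simp: matroid_morphism_def)
qed

text \<open>A morphism sends circuits of \<open>N\<close>, which are vectors, to vectors of \<open>M\<close>; these are orthogonal to
  the cocircuits of \<open>M\<close>. Passing to the adjoint moves the matrix to the cocircuit.\<close>

lemma transpose_cocircuit_covector:
  assumes "matroid_morphism F N M \<Phi>"
    and "grassmann_pluecker F (ground M) (mrank M) \<phi>" "gpclass M = gp_class F (ground M) (mrank M) \<phi>"
    and "set xs \<subseteq> ground M" "Suc (length xs) = mrank M"
  shows "mat_vec F (ground N) (ground M) (transpose_matrix (ground M) (ground N) \<Phi>) (\<lambda>e. \<phi> (e # xs))
    \<in> covectors F N" (is "?Z \<in> _")
proof -
  let ?S = "ground N" and ?T = "ground M" and ?Y = "\<lambda>e. \<phi> (e # xs)"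
  have mat: "is_matroid F N" "submonomial F ?T ?S \<Phi>" "finite ?T"
    using assms(1) by (auto simp: matroid_morphism_def is_matroid_def)
  have maps: "mat_vec F ?T ?S \<Phi> X \<in> vectors F M" if "X \<in> vectors F N" for X
    using assms(1) that by (auto simp: matroid_morphism_def)
  obtain \<psi> where N: "finite ?S" "grassmann_pluecker F ?S (mrank N) \<psi>"
      "gpclass N = gp_class F ?S (mrank N) \<psi>"
    using is_matroidE[OF mat(1)] .
  have Y: "?Y \<in> ?T \<rightarrow> carrier F"
    using assms(4,5) gp_closed[OF assms(2)] by (auto simp: tuples_def Pi_iff)
  have Z: "?Z \<in> ?S \<rightarrow>\<^sub>E carrier F"
    by (rule mat_vec_closed[OF submonomial_transpose[OF mat(2)] Y])
  then have Z': "?Z \<in> ?S \<rightarrow> carrier F"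
    by (simp add: PiE_def)
  have "orthogonal F ?S ?Z (fund_circuit F ?S \<psi> ys)"
    if ys: "ys \<in> tuples ?S (Suc (mrank N))" "distinct ys" for ys
  proof -
    let ?C = "fund_circuit F ?S \<psi> ys"
    have C: "?C \<in> vectors F N"
      by (rule fund_circuit_in_vectors[OF N ys])
    then have C': "?C \<in> ?S \<rightarrow> carrier F"
      using vectors_closed by (auto simp: PiE_def)
    have "orthogonal F ?T (mat_vec F ?T ?S \<Phi> ?C) ?Y"
      using vectors_iff[OF mat(3) assms(2,3)] maps[OF C] assms(4,5) by blast
    then show ?thesis
      using orthogonal_adjoint[OF N(1) mat(3,2) C' Y] orthogonal_commute[OF N(1) C' Z'] by blast
  qed
  then show ?thesis
    using orthogonal_circuits_iff[OF N(1,3) gp_closed[OF N(2)] Z'] Z by (simp add: covectors_def)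
qed

lemma Mat_simps:
  "x \<in> Obj (Mat F) \<longleftrightarrow> is_matroid F x"
  "h \<in> Hom (Mat F) x y \<longleftrightarrow> matroid_morphism F x y h"
  "Id (Mat F) x = mat_id F (ground x)"
  "Comp (Mat F) x y z g h = mat_mult F (ground z) (ground y) (ground x) g h"
  by (simp_all add: Mat_def)

lemma morphism_submonomial:
  "matroid_morphism F N M \<Phi> \<Longrightarrow> submonomial F (ground M) (ground N) \<Phi>"
  by (simp add: matroid_morphism_def)

lemma is_category_Mat: "is_category (Mat F)"
  unfolding is_category_def Mat_simps
proof (intro conjI ballI; unfold Mat_simps)
  fix x :: "('e, 'a) pre_matroid"
  assume "is_matroid F x"
  then show "matroid_morphism F x x (mat_id F (ground x))"
    by (rule matroid_morphism_id)
next
  fix x y z :: "('e, 'a) pre_matroid" and h g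
  assume "matroid_morphism F x y h" "matroid_morphism F y z g"
  then show "matroid_morphism F x z (mat_mult F (ground z) (ground y) (ground x) g h)"
    by (rule matroid_morphism_comp)
next
  fix x y :: "('e, 'a) pre_matroid" and h
  assume "matroid_morphism F x y h"
  then show "mat_mult F (ground y) (ground x) (ground x) h (mat_id F (ground x)) = h"
    by (intro mat_mult_mat_id_right morphism_submonomial)
next
  fix x y :: "('e, 'a) pre_matroid" and h
  assume "matroid_morphism F x y h"
  then show "mat_mult F (ground y) (ground y) (ground x) (mat_id F (ground y)) h = h"
    by (intro mat_mult_mat_id_left morphism_submonomial)
next
  fix w x y z :: "('e, 'a) pre_matroid" and h g k
  assume "matroid_morphism F w x h" "matroid_morphism F x y g" "matroid_morphism F y z k"
  then show "mat_mult F (ground z) (ground x) (ground w)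
      (mat_mult F (ground z) (ground y) (ground x) k g) h =
    mat_mult F (ground z) (ground y) (ground w) k
      (mat_mult F (ground y) (ground x) (ground w) g h)"
    by (intro mat_mult_assoc morphism_submonomial)
qed

end

section \<open>Push-forward along a morphism of idylls\<close>

locale idyll_morphism = source: idyll F + target: idyll G
  for F :: "('a, 'm) pre_idyll_scheme" and G :: "('b, 'n) pre_idyll_scheme" +
  fixes f :: "'a \<Rightarrow> 'b"
  assumes idyll_hom: "idyll_hom F G f"
begin

lemma f_closed: "a \<in> carrier F \<Longrightarrow> f a \<in> carrier G"
  and f_mult: "a \<in> carrier F \<Longrightarrow> b \<in> carrier F \<Longrightarrow> f (a \<otimes>\<^bsub>F\<^esub> b) = f a \<otimes>\<^bsub>G\<^esub> f b"
  and f_zer: "f (zer F) = zer G"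
  and f_one: "f \<one>\<^bsub>F\<^esub> = \<one>\<^bsub>G\<^esub>"
  and f_nullset: "A \<in> nullset F \<Longrightarrow> is_null G (image_mset f A)"
  using idyll_hom by (auto simp: idyll_hom_def hom_def)

text \<open>Units go to units, and \<open>0\<close> is not a unit in \<open>G\<close>.\<close>

lemma f_nonzero:
  assumes "a \<in> nonzero F"
  shows "f a \<in> nonzero G"
proof -
  obtain b where b: "b \<in> nonzero F" "b \<otimes>\<^bsub>F\<^esub> a = \<one>\<^bsub>F\<^esub>"
    using source.inverse_exists[OF assms] .
  have carr: "a \<in> carrier F" "b \<in> carrier F"
    using assms b by (auto dest: source.nonzeroD)
  then have "f b \<otimes>\<^bsub>G\<^esub> f a = \<one>\<^bsub>G\<^esub>"
    using f_mult b(2) f_one by metis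
  then have "f a \<noteq> zer G"
    using target.zer_mult_right[of "f b"] f_closed[OF carr(2)] target.one_neq_zer by auto
  then show ?thesis
    using f_closed[OF carr(1)] by (simp add: nonzero_def)
qed

lemma f_eq_zer_iff: "a \<in> carrier F \<Longrightarrow> f a = zer G \<longleftrightarrow> a = zer F"
  using f_nonzero[of a] by (auto simp: nonzero_def f_zer)

lemma f_neg_one: "f (neg_one F) = neg_one G"
proof (rule target.neg_one_unique)
  show nz: "f (neg_one F) \<in> nonzero G"
    using f_nonzero source.neg_one_nonzero .
  show "{#\<one>\<^bsub>G\<^esub>, f (neg_one F)#} \<in> nullset G"
    using f_nullset[OF source.one_neg_one_null] nz
    by (simp add: is_null_def f_one target.one_neq_zer nonzero_def)
qed

lemma f_of_sign: "f (of_sign F s) = of_sign G s"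
  by (simp add: of_sign_def f_one f_neg_one)

lemma f_neg_one_pow: "f (neg_one F [^]\<^bsub>F\<^esub> (k::nat)) = neg_one G [^]\<^bsub>G\<^esub> k"
  by (simp add: source.neg_one_pow target.neg_one_pow f_of_sign)

lemma is_null_push: "is_null F A \<Longrightarrow> is_null G (image_mset f A)"
proof -
  assume "is_null F A"
  then have "is_null G (image_mset f {#a \<in># A. a \<noteq> zer F#})"
    by (intro f_nullset) (simp add: is_null_def)
  moreover have "{#b \<in># image_mset f {#a \<in># A. a \<noteq> zer F#}. b \<noteq> zer G#} =
      {#b \<in># image_mset f A. b \<noteq> zer G#}"
    by (simp add: filter_mset_image_mset filter_filter_mset o_def)
      (intro arg_cong[where f = "image_mset f"] filter_mset_cong refl, auto simp: f_zer)
  ultimately show ?thesis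
    by (simp add: is_null_def)
qed

lemma gp_push:
  assumes "grassmann_pluecker F E r \<phi>"
  shows "grassmann_pluecker G E r (\<lambda>xs\<in>tuples E r. f (\<phi> xs))" (is "grassmann_pluecker G E r ?\<phi>")
  unfolding grassmann_pluecker_def
proof (intro conjI)
  note closed = source.gp_closed[OF assms]
  show "?\<phi> \<in> tuples E r \<rightarrow>\<^sub>E carrier G"
    using closed f_closed by auto
  show "\<exists>xs\<in>tuples E r. ?\<phi> xs \<noteq> zer G"
  proof -
    obtain xs where "xs \<in> tuples E r" "\<phi> xs \<noteq> zer F"
      using assms by (auto simp: grassmann_pluecker_def)
    then show ?thesis
      using closed f_eq_zer_iff[of "\<phi> xs"] by (intro bexI[of _ xs]) auto
  qed
  show "\<forall>xs\<in>tuples E r. \<forall>\<sigma>. \<sigma> permutes {..<r} \<longrightarrow>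
      ?\<phi> (permute_list \<sigma> xs) = of_sign G (sign \<sigma>) \<otimes>\<^bsub>G\<^esub> ?\<phi> xs"
  proof (intro ballI allI impI)
    fix xs \<sigma>
    assume xs: "xs \<in> tuples E r" and \<sigma>: "\<sigma> permutes {..<r}"
    have "\<phi> xs \<in> carrier F"
      using closed xs by blast
    then show "?\<phi> (permute_list \<sigma> xs) = of_sign G (sign \<sigma>) \<otimes>\<^bsub>G\<^esub> ?\<phi> xs"
      using source.gp_permute[OF assms xs \<sigma>] permute_list_tuples[OF xs \<sigma>] xs
      by (simp add: f_mult source.of_sign_closed f_of_sign)
  qed
  show "\<forall>xs\<in>tuples E r. \<not> distinct xs \<longrightarrow> ?\<phi> xs = zer G"
    using source.gp_not_distinct[OF assms] by (simp add: f_zer)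
  show "\<forall>xs ys. set xs \<subseteq> E \<and> Suc (length xs) = r \<and> ys \<in> tuples E (Suc r) \<longrightarrow>
      is_null G {#neg_one G [^]\<^bsub>G\<^esub> k \<otimes>\<^bsub>G\<^esub> ?\<phi> (omit k ys) \<otimes>\<^bsub>G\<^esub> ?\<phi> (ys ! k # xs).
        k \<in># mset_set {0..r}#}"
  proof (intro allI impI, elim conjE)
    fix xs ys
    assume xs: "set xs \<subseteq> E" "Suc (length xs) = r" and ys: "ys \<in> tuples E (Suc r)"
    have "image_mset f {#neg_one F [^]\<^bsub>F\<^esub> k \<otimes>\<^bsub>F\<^esub> \<phi> (omit k ys) \<otimes>\<^bsub>F\<^esub> \<phi> (ys ! k # xs).
          k \<in># mset_set {0..r}#} =
        {#neg_one G [^]\<^bsub>G\<^esub> k \<otimes>\<^bsub>G\<^esub> ?\<phi> (omit k ys) \<otimes>\<^bsub>G\<^esub> ?\<phi> (ys ! k # xs).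
          k \<in># mset_set {0..r}#}"
      unfolding multiset.map_comp o_def
    proof (intro image_mset_cong)
      fix k
      assume "k \<in># mset_set {0..r}"
      then have k: "k \<le> r" by simp
      then have om: "omit k ys \<in> tuples E r" and sub: "ys ! k # xs \<in> tuples E r"
        using xs ys nth_mem[of k ys] omit_tuples[OF ys] by (auto simp: tuples_def)
      have "\<phi> (omit k ys) \<in> carrier F" "\<phi> (ys ! k # xs) \<in> carrier F"
        using closed om sub by blast+
      then show "f (neg_one F [^]\<^bsub>F\<^esub> k \<otimes>\<^bsub>F\<^esub> \<phi> (omit k ys) \<otimes>\<^bsub>F\<^esub> \<phi> (ys ! k # xs)) =
          neg_one G [^]\<^bsub>G\<^esub> k \<otimes>\<^bsub>G\<^esub> ?\<phi> (omit k ys) \<otimes>\<^bsub>G\<^esub> ?\<phi> (ys ! k # xs)"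
        using om sub by (simp add: f_mult f_neg_one_pow source.neg_one_closed)
    qed
    then show "is_null G {#neg_one G [^]\<^bsub>G\<^esub> k \<otimes>\<^bsub>G\<^esub> ?\<phi> (omit k ys) \<otimes>\<^bsub>G\<^esub> ?\<phi> (ys ! k # xs).
        k \<in># mset_set {0..r}#}"
      using is_null_push[OF source.gp_null[OF assms xs ys]] by metis
  qed
qed

lemma gpclass_push:
  assumes "grassmann_pluecker F (ground M) (mrank M) \<phi>"
    and "gpclass M = gp_class F (ground M) (mrank M) \<phi>"
  shows "gpclass (push_matroid G f M) =
    gp_class G (ground M) (mrank M) (\<lambda>xs\<in>tuples (ground M) (mrank M). f (\<phi> xs))"
proof -
  let ?T = "tuples (ground M) (mrank M)"
  have "(\<Union>\<psi>\<in>gpclass M. gp_class G (ground M) (mrank M) (\<lambda>xs\<in>?T. f (\<psi> xs))) =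
      gp_class G (ground M) (mrank M) (\<lambda>xs\<in>?T. f (\<phi> xs))"
  proof (rule target.UN_gp_class[OF target.gp_closed[OF gp_push[OF assms(1)]]])
    show "gpclass M \<noteq> {}"
      using source.gp_class_nonempty by (simp add: assms(2))
    fix \<psi>
    assume "\<psi> \<in> gpclass M"
    then obtain a where a: "a \<in> nonzero F" "\<psi> = (\<lambda>xs\<in>?T. a \<otimes>\<^bsub>F\<^esub> \<phi> xs)"
      unfolding assms(2) gp_class_def by blast
    have "f (a \<otimes>\<^bsub>F\<^esub> \<phi> xs) = f a \<otimes>\<^bsub>G\<^esub> f (\<phi> xs)" if "xs \<in> ?T" for xs
      using that source.gp_closed[OF assms(1)] a(1) by (intro f_mult) (auto dest: source.nonzeroD)
    then have "(\<lambda>xs\<in>?T. f (\<psi> xs)) = (\<lambda>xs\<in>?T. f a \<otimes>\<^bsub>G\<^esub> (\<lambda>xs\<in>?T. f (\<phi> xs)) xs)"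
      unfolding a(2) by (intro restrict_ext) simp
    with f_nonzero[OF a(1)] show "\<exists>b\<in>nonzero G. (\<lambda>xs\<in>?T. f (\<psi> xs)) =
        (\<lambda>xs\<in>?T. b \<otimes>\<^bsub>G\<^esub> (\<lambda>xs\<in>?T. f (\<phi> xs)) xs)"
      by blast
  qed
  then show ?thesis
    by (simp add: push_matroid_def)
qed

lemma ground_push: "ground (push_matroid G f M) = ground M"
  and mrank_push: "mrank (push_matroid G f M) = mrank M"
  by (simp_all add: push_matroid_def)

lemma is_matroid_push:
  assumes "is_matroid F M"
  shows "is_matroid G (push_matroid G f M)"
proof -
  obtain \<phi> where "finite (ground M)" "grassmann_pluecker F (ground M) (mrank M) \<phi>"
    "gpclass M = gp_class F (ground M) (mrank M) \<phi>"
    using is_matroidE[OF assms] .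
  then show ?thesis
    unfolding is_matroid_def ground_push mrank_push using gp_push gpclass_push by blast
qed

text \<open>The null sums that define covectors are expressions in the values of \<open>\<phi>\<close> and \<open>Z\<close>, to which \<open>f\<close>
  can be applied term by term.\<close>

lemma covectors_push:
  assumes "is_matroid F M" "Z \<in> covectors F M"
  shows "(\<lambda>e\<in>ground M. f (Z e)) \<in> covectors G (push_matroid G f M)"
proof -
  let ?E = "ground M" and ?r = "mrank M"
  obtain \<phi> where M: "finite ?E" "grassmann_pluecker F ?E ?r \<phi>" "gpclass M = gp_class F ?E ?r \<phi>"
    using is_matroidE[OF assms(1)] .
  let ?\<phi> = "\<lambda>xs\<in>tuples ?E ?r. f (\<phi> xs)" and ?Z = "\<lambda>e\<in>?E. f (Z e)"
  have Z: "Z \<in> ?E \<rightarrow> carrier F"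
    using assms(2) by (auto simp: covectors_def PiE_def)
  have "is_null G {#neg_one G [^]\<^bsub>G\<^esub> k \<otimes>\<^bsub>G\<^esub> ?\<phi> (omit k ys) \<otimes>\<^bsub>G\<^esub> ?Z (ys ! k). k \<in># mset_set {0..?r}#}"
    if ys: "ys \<in> tuples ?E (Suc ?r)" "distinct ys" for ys
  proof -
    have "image_mset f {#neg_one F [^]\<^bsub>F\<^esub> k \<otimes>\<^bsub>F\<^esub> \<phi> (omit k ys) \<otimes>\<^bsub>F\<^esub> Z (ys ! k). k \<in># mset_set {0..?r}#} =
        {#neg_one G [^]\<^bsub>G\<^esub> k \<otimes>\<^bsub>G\<^esub> ?\<phi> (omit k ys) \<otimes>\<^bsub>G\<^esub> ?Z (ys ! k). k \<in># mset_set {0..?r}#}"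
      unfolding multiset.map_comp o_def
    proof (intro image_mset_cong)
      fix k
      assume "k \<in># mset_set {0..?r}"
      then have k: "k \<le> ?r" by simp
      then have om: "omit k ys \<in> tuples ?E ?r" and e: "ys ! k \<in> ?E"
        using nth_mem[of k ys] omit_tuples[OF ys(1)] ys(1) by (auto simp: tuples_def)
      have "\<phi> (omit k ys) \<in> carrier F" "Z (ys ! k) \<in> carrier F"
        using source.gp_closed[OF M(2)] om Z e by blast+
      then show "f (neg_one F [^]\<^bsub>F\<^esub> k \<otimes>\<^bsub>F\<^esub> \<phi> (omit k ys) \<otimes>\<^bsub>F\<^esub> Z (ys ! k)) =
          neg_one G [^]\<^bsub>G\<^esub> k \<otimes>\<^bsub>G\<^esub> ?\<phi> (omit k ys) \<otimes>\<^bsub>G\<^esub> ?Z (ys ! k)"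
        using om e by (simp add: f_mult f_neg_one_pow source.neg_one_closed)
    qed
    moreover have "is_null F {#neg_one F [^]\<^bsub>F\<^esub> k \<otimes>\<^bsub>F\<^esub> \<phi> (omit k ys) \<otimes>\<^bsub>F\<^esub> Z (ys ! k).
        k \<in># mset_set {0..?r}#}"
      using source.covectors_iff[OF M] assms(2) ys by blast
    ultimately show ?thesis
      using is_null_push by metis
  qed
  moreover have "?Z \<in> ?E \<rightarrow>\<^sub>E carrier G"
    using Z f_closed by auto
  ultimately show ?thesis
    using target.covectors_iff[of "push_matroid G f M" ?\<phi> ?Z] M gp_push[OF M(2)] gpclass_push[OF M(2,3)]
    by (simp add: ground_push mrank_push)
qed

lemma push_matrix_entry: "i \<in> T \<Longrightarrow> j \<in> S \<Longrightarrow> push_matrix f T S \<Phi> (i, j) = f (\<Phi> (i, j))"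
  by (simp add: push_matrix_def)

lemma push_matrix_zer_iff:
  "submonomial F T S \<Phi> \<Longrightarrow> i \<in> T \<Longrightarrow> j \<in> S \<Longrightarrow>
    push_matrix f T S \<Phi> (i, j) = zer G \<longleftrightarrow> \<Phi> (i, j) = zer F"
  using f_eq_zer_iff[of "\<Phi> (i, j)"] submonomial_closed[of F T S \<Phi> i j]
  by (simp add: push_matrix_entry)

lemma submonomial_push:
  assumes "submonomial F T S \<Phi>"
  shows "submonomial G T S (push_matrix f T S \<Phi>)"
proof (rule submonomialI)
  show "push_matrix f T S \<Phi> \<in> T \<times> S \<rightarrow>\<^sub>E carrier G"
    using submonomial_closed[OF assms] f_closed by (auto simp: push_matrix_def)
  show "j = k" if "i \<in> T" "j \<in> S" "k \<in> S"
    "push_matrix f T S \<Phi> (i, j) \<noteq> zer G" "push_matrix f T S \<Phi> (i, k) \<noteq> zer G" for i j k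
    using that push_matrix_zer_iff[OF assms] submonomial_row[OF assms, of i j k] by blast
  show "i = k" if "j \<in> S" "i \<in> T" "k \<in> T"
    "push_matrix f T S \<Phi> (i, j) \<noteq> zer G" "push_matrix f T S \<Phi> (k, j) \<noteq> zer G" for i j k
    using that push_matrix_zer_iff[OF assms] submonomial_col[OF assms, of j i k] by blast
qed

lemma push_mat_vec:
  assumes "submonomial F T S \<Phi>" "X \<in> S \<rightarrow> carrier F" "\<And>j. j \<in> S \<Longrightarrow> X' j = f (X j)" "i \<in> T"
  shows "mat_vec G T S (push_matrix f T S \<Phi>) X' i = f (mat_vec F T S \<Phi> X i)"
proof -
  note P = submonomial_push[OF assms(1)]
  have X': "X' \<in> S \<rightarrow> carrier G"
  proof
    fix j
    assume j: "j \<in> S"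
    have "X j \<in> carrier F"
      using assms(2) j by blast
    then show "X' j \<in> carrier G"
      unfolding assms(3)[OF j] by (rule f_closed)
  qed
  show ?thesis
  proof (cases "\<exists>j \<in> S. \<Phi> (i, j) \<noteq> zer F")
    case True
    then obtain j where j: "j \<in> S" "\<Phi> (i, j) \<noteq> zer F"
      by blast
    have "X j \<in> carrier F"
      using assms(2) j(1) by blast
    then have "f (mat_vec F T S \<Phi> X i) = f (\<Phi> (i, j)) \<otimes>\<^bsub>G\<^esub> f (X j)"
      using source.mat_vec_row[OF assms(1,2,4) j] submonomial_closed[OF assms(1,4) j(1)] f_mult by simp
    then show ?thesis
      using target.mat_vec_row[OF P X' assms(4) j(1)] push_matrix_zer_iff[OF assms(1,4) j(1)] j
        push_matrix_entry[OF assms(4) j(1)] assms(3) by simp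
  next
    case False
    then have "mat_vec G T S (push_matrix f T S \<Phi>) X' i = zer G"
      using push_matrix_zer_iff[OF assms(1,4)] by (intro target.mat_vec_zer_row[OF X' assms(4)]) blast
    moreover have "mat_vec F T S \<Phi> X i = zer F"
      using False by (intro source.mat_vec_zer_row[OF assms(2,4)]) blast
    ultimately show ?thesis
      by (simp add: f_zer)
  qed
qed

lemma push_mat_mult:
  assumes "submonomial F U T \<Psi>" "submonomial F T S \<Phi>"
  shows "push_matrix f U S (mat_mult F U T S \<Psi> \<Phi>) =
    mat_mult G U T S (push_matrix f U T \<Psi>) (push_matrix f T S \<Phi>)"
proof (rule extensionalityI)
  fix p
  assume "p \<in> U \<times> S"
  then obtain i k where p: "p = (i, k)" "i \<in> U" "k \<in> S"
    by blast
  have "mat_vec G U T (push_matrix f U T \<Psi>) (\<lambda>j. push_matrix f T S \<Phi> (j, k)) i =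
      f (mat_vec F U T \<Psi> (\<lambda>j. \<Phi> (j, k)) i)"
    using submonomial_closed[OF assms(2) _ p(3)] p(3)
    by (intro push_mat_vec[OF assms(1) _ _ p(2)]) (auto simp: push_matrix_entry)
  then show "push_matrix f U S (mat_mult F U T S \<Psi> \<Phi>) p =
      mat_mult G U T S (push_matrix f U T \<Psi>) (push_matrix f T S \<Phi>) p"
    using p by (simp add: push_matrix_entry source.mat_mult_eq_mat_vec target.mat_mult_eq_mat_vec)
qed (simp_all add: push_matrix_def mat_mult_def)

lemma push_mat_id: "push_matrix f S S (mat_id F S) = mat_id G S"
proof (rule extensionalityI)
  show "push_matrix f S S (mat_id F S) p = mat_id G S p" if "p \<in> S \<times> S" for p
    using that by (cases p) (simp add: push_matrix_def mat_id_def f_one f_zer)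
qed (simp_all add: push_matrix_def mat_id_def)

lemma push_transpose:
  "transpose_matrix T S (push_matrix f T S \<Phi>) = push_matrix f S T (transpose_matrix T S \<Phi>)"
proof (rule extensionalityI)
  show "transpose_matrix T S (push_matrix f T S \<Phi>) p = push_matrix f S T (transpose_matrix T S \<Phi>) p"
    if "p \<in> S \<times> T" for p
    using that by (cases p) (simp add: push_matrix_def transpose_matrix_def)
qed (simp_all add: push_matrix_def transpose_matrix_def)

text \<open>For a vector \<open>X\<close> of \<open>f\<^sub>* N\<close> and a cocircuit \<open>Y'\<close> of \<open>f\<^sub>* M\<close>, which up to a unit is the image of a
  cocircuit of \<open>M\<close>, the orthogonality of \<open>(f\<^sub>* \<Phi>) X\<close> and \<open>Y'\<close> is moved to the side of \<open>N\<close> by the adjoint. There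
  the transposed matrix applied to \<open>Y'\<close> is the image of a covector of \<open>N\<close>, so perfection of \<open>G\<close>
  applies.\<close>

lemma matroid_morphism_push:
  assumes "perfect_idyll G" "matroid_morphism F N M \<Phi>"
  shows "matroid_morphism G (push_matroid G f N) (push_matroid G f M)
    (push_matrix f (ground M) (ground N) \<Phi>)"
proof -
  let ?S = "ground N" and ?T = "ground M"
  let ?N = "push_matroid G f N" and ?M = "push_matroid G f M" and ?\<Phi> = "push_matrix f ?T ?S \<Phi>"
  have mat: "is_matroid F N" "is_matroid F M" "submonomial F ?T ?S \<Phi>" "finite ?S"
    using assms(2) by (auto simp: matroid_morphism_def is_matroid_def)
  obtain \<phi> where M: "finite ?T" "grassmann_pluecker F ?T (mrank M) \<phi>"
      "gpclass M = gp_class F ?T (mrank M) \<phi>"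
    using is_matroidE[OF mat(2)] .
  let ?\<phi> = "\<lambda>xs\<in>tuples ?T (mrank M). f (\<phi> xs)"
  note sub = submonomial_push[OF mat(3)]
  have "mat_vec G ?T ?S ?\<Phi> X \<in> vectors G ?M" if X: "X \<in> vectors G ?N" for X
  proof -
    have X_closed: "X \<in> ?S \<rightarrow> carrier G"
      using target.vectors_closed[OF X] by (auto simp: PiE_def ground_push)
    have "orthogonal G ?T (mat_vec G ?T ?S ?\<Phi> X) (\<lambda>e. ?\<phi> (e # xs))"
      if xs: "set xs \<subseteq> ?T" "Suc (length xs) = mrank M" for xs
    proof -
      let ?Y = "\<lambda>e. \<phi> (e # xs)" and ?Y' = "\<lambda>e. ?\<phi> (e # xs)"
      let ?Z = "mat_vec F ?S ?T (transpose_matrix ?T ?S \<Phi>) ?Y"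
      let ?Z' = "mat_vec G ?S ?T (transpose_matrix ?T ?S ?\<Phi>) ?Y'"
      have tup: "e # xs \<in> tuples ?T (mrank M)" if "e \<in> ?T" for e
        using that xs by (auto simp: tuples_def)
      have Y: "?Y \<in> ?T \<rightarrow> carrier F"
        using tup source.gp_closed[OF M(2)] by blast
      have Y': "?Y' \<in> ?T \<rightarrow> carrier G"
        using tup target.gp_closed[OF gp_push[OF M(2)]] by blast
      have "?Z' = (\<lambda>e\<in>?S. f (?Z e))"
      proof (rule extensionalityI)
        show "?Z' e = (\<lambda>e\<in>?S. f (?Z e)) e" if "e \<in> ?S" for e
          using push_mat_vec[OF submonomial_transpose[OF mat(3)] Y _ that, of ?Y'] tup that
          by (simp add: push_transpose)
      qed (simp_all add: mat_vec_def)
      also have "\<dots> \<in> covectors G ?N"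
        by (intro covectors_push mat source.transpose_cocircuit_covector[OF assms(2) M(2,3) xs])
      finally have "orthogonal G (ground ?N) X ?Z'"
        by (rule target.perfect_orthogonal[OF assms(1) is_matroid_push[OF mat(1)] X])
      then show ?thesis
        using target.orthogonal_adjoint[OF mat(4) M(1) sub X_closed Y'] by (simp add: ground_push)
    qed
    moreover have "mat_vec G ?T ?S ?\<Phi> X \<in> ?T \<rightarrow>\<^sub>E carrier G"
      by (rule target.mat_vec_closed[OF sub X_closed])
    ultimately show ?thesis
      using target.vectors_iff[of ?M ?\<phi>] M gp_push[OF M(2)] gpclass_push[OF M(2,3)]
      by (simp add: ground_push mrank_push)
  qed
  then show ?thesis
    using sub is_matroid_push[OF mat(1)] is_matroid_push[OF mat(2)]
    by (auto simp: matroid_morphism_def ground_push)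
qed

lemma is_functor_push:
  assumes "perfect_idyll G"
  shows "is_functor (Mat F :: (('e, 'a) pre_matroid, 'e \<times> 'e \<Rightarrow> 'a) cat) (Mat G)
    (push_matroid G f) (\<lambda>N M. push_matrix f (ground M) (ground N))"
  unfolding is_functor_def source.Mat_simps target.Mat_simps
proof (intro conjI ballI source.is_category_Mat target.is_category_Mat;
    unfold source.Mat_simps target.Mat_simps ground_push)
  fix x :: "('e, 'a) pre_matroid"
  assume "is_matroid F x"
  then show "is_matroid G (push_matroid G f x)"
    by (rule is_matroid_push)
next
  fix x y :: "('e, 'a) pre_matroid" and h
  assume "matroid_morphism F x y h"
  then show "matroid_morphism G (push_matroid G f x) (push_matroid G f y)
      (push_matrix f (ground y) (ground x) h)"
    by (rule matroid_morphism_push[OF assms])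
next
  fix x :: "('e, 'a) pre_matroid"
  show "push_matrix f (ground x) (ground x) (mat_id F (ground x)) = mat_id G (ground x)"
    by (rule push_mat_id)
next
  fix x y z :: "('e, 'a) pre_matroid" and h g
  assume "matroid_morphism F x y h" "matroid_morphism F y z g"
  then show "push_matrix f (ground z) (ground x) (mat_mult F (ground z) (ground y) (ground x) g h) =
      mat_mult G (ground z) (ground y) (ground x)
        (push_matrix f (ground z) (ground y) g) (push_matrix f (ground y) (ground x) h)"
    by (intro push_mat_mult source.morphism_submonomial)
qed

end

theorem propositionA:
  fixes F :: "('a, 'm) pre_idyll_scheme" and G :: "('b, 'n) pre_idyll_scheme" and f :: "'a \<Rightarrow> 'b"
  assumes "perfect_idyll F" and "perfect_idyll G" and "idyll_hom F G f"
  shows "(\<forall>(N :: ('s, 'a) pre_matroid) (M :: ('t, 'a) pre_matroid) \<Phi>.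
            matroid_morphism F N M \<Phi> \<longrightarrow>
            matroid_morphism G (push_matroid G f N) (push_matroid G f M)
              (push_matrix f (ground M) (ground N) \<Phi>)) \<and>
         is_functor (Mat F :: (('e, 'a) pre_matroid, 'e \<times> 'e \<Rightarrow> 'a) cat) (Mat G)
           (push_matroid G f) (\<lambda>N M. push_matrix f (ground M) (ground N))"
proof -
  interpret idyll_morphism F G f
    using assms by (simp add: idyll_morphism_def idyll_morphism_axioms_def perfect_idyll_def)
  show ?thesis
    using matroid_morphism_push is_functor_push assms(2) by blast
qed

end
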